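(* Let $m\ge 1$ be an integer and let $F(t;x,y)\equiv F^{(m)}(t;x,y)=\sum_{I=[P,Q]} \frac{t^{|I|}}{|I|!}\,x^{c(P)}y^{r(Q)}$ be the exponential generating function of labelled $m$-Tamari intervals. Let $z$ and $u$ be two indeterminates, and write $$t=z e^{-m(m+1)z}\quad\text{and}\quad x=(1+u)e^{-mzu}.$$ Then $F(t;x,1)$ becomes a formal power series in $z$ with polynomial coefficients in $u$, and $$F(t;x,1)=(1+u)\,e^{(m+1)z-(m-1)zu}\left(1+\frac{1-e^{mzu}}{u}\right).$$ In particular, $$F(t;1,1)=(1-mz)\,e^{(m+1)z},$$ and the number of labelled $m$-Tamari intervals of size $n$ is $$n!\,[t^n]F(t;1,1)=(m+1)^n(mn+1)^{n-2}.$$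
   Context: An $m$-ballot path of size $n$ is a path on the square grid consisting of north and east unit steps, starting at $(0,0)$, ending at $(mn,n)$, and never going below the line $\{x=my\}$. The set $\mathcal{T}_n^{(m)}$ of $m$-ballot paths of size $n$ is partially ordered (the $m$-Tamari lattice) by the order whose covering relation is: $Q$ covers $P$ if there exists in $P$ an east step $a$ followed by a north step $b$ such that $Q$ is obtained from $P$ by swapping $a$ and $S$, where $S$ is the shortest factor of $P$ (sequence of consecutive steps) that begins with $b$ and is a (translated) $m$-ballot path. An $m$-Tamari interval $I=[P,Q]$ is an interval of this order, given by a pair of paths $P\preceq Q$ in $\mathcal{T}_n^{(m)}$; its size is $|I|=n$. It is labelled if the north steps of the upper path $Q$ are labelled with $1,\dots,n$ (each label used once) in such a way that labels increase along any sequence of consecutive north steps. A contact of $P$ is a vertex of $P$ lying on the line $\{x=my\}$, and $c(P)$ is the number of contacts of the lower path $P$ (the path of size $0$ has one contact). The initial rise $r(Q)$ is the length of the initial run of north steps of the upper path $Q$. The sum defining $F^{(m)}$ runs over all labelled $m$-Tamari intervals of all sizes $n\ge 0$. $[t^n]$ denotes extraction of the coefficient of $t^n$. *)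

theory Defs
  imports
    "HOL-Computational_Algebra.Computational_Algebra"
    "HOL-Library.FuncSet"
begin

section \<open>Ballot paths and the m-Tamari order\<close>

datatype step = North | East

text \<open>A path starts at the origin; the vertex reached after \<open>k\<close> steps is
  \<open>(count_list (take k P) East, count_list (take k P) North)\<close>. A vertex \<open>(x, y)\<close> is
  not below the line \<open>x = m y\<close> iff \<open>x \<le> m y\<close>.\<close>

definition ballot_path :: "nat \<Rightarrow> nat \<Rightarrow> step list \<Rightarrow> bool" where
  "ballot_path m n P \<longleftrightarrow>
     count_list P North = n \<and> count_list P East = m * n \<and>
     (\<forall>k\<le>length P. count_list (take k P) East \<le> m * count_list (take k P) North)"

definition ballot_paths :: "nat \<Rightarrow> nat \<Rightarrow> step list set" where
  "ballot_paths m n = {P. ballot_path m n P}"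

text \<open>\<open>S\<close> is the shortest factor of \<open>P\<close> that begins with the north step following the
  distinguished east step and is a translated ballot path (of any size).\<close>

definition tamari_cover :: "nat \<Rightarrow> step list \<Rightarrow> step list \<Rightarrow> bool" where
  "tamari_cover m P Q \<longleftrightarrow>
     (\<exists>A S B. P = A @ [East] @ S @ B \<and> Q = A @ S @ [East] @ B \<and>
        S \<noteq> [] \<and> hd S = North \<and> (\<exists>j. ballot_path m j S) \<and>
        (\<forall>S' B'. S @ B = S' @ B' \<and> S' \<noteq> [] \<and> (\<exists>j. ballot_path m j S')
                 \<longrightarrow> length S \<le> length S'))"

definition tamari_le :: "nat \<Rightarrow> step list \<Rightarrow> step list \<Rightarrow> bool" where
  "tamari_le m = (tamari_cover m)\<^sup>*\<^sup>*"

definition tamari_intervals :: "nat \<Rightarrow> nat \<Rightarrow> (step list \<times> step list) set" where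
  "tamari_intervals m n =
     {(P, Q). P \<in> ballot_paths m n \<and> Q \<in> ballot_paths m n \<and> tamari_le m P Q}"

section \<open>Labelled intervals\<close>

definition north_positions :: "step list \<Rightarrow> nat set" where
  "north_positions Q = {i. i < length Q \<and> Q ! i = North}"

text \<open>A labelling is a function on the positions of the north steps; it is taken to be
  extensional so that labellings are counted once each.\<close>

definition labellings :: "nat \<Rightarrow> step list \<Rightarrow> (nat \<Rightarrow> nat) set" where
  "labellings n Q =
     {l \<in> north_positions Q \<rightarrow>\<^sub>E {1..n}.
        bij_betw l (north_positions Q) {1..n} \<and>
        (\<forall>i j. i < j \<and> {i..j} \<subseteq> north_positions Q \<longrightarrow> l i < l j)}"

definition labelled_intervals ::
  "nat \<Rightarrow> nat \<Rightarrow> (step list \<times> step list \<times> (nat \<Rightarrow> nat)) set" where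
  "labelled_intervals m n =
     {(P, Q, l). (P, Q) \<in> tamari_intervals m n \<and> l \<in> labellings n Q}"

definition contacts :: "nat \<Rightarrow> step list \<Rightarrow> nat" where
  "contacts m P =
     card {k. k \<le> length P \<and> count_list (take k P) East = m * count_list (take k P) North}"

definition initial_rise :: "step list \<Rightarrow> nat" where
  "initial_rise Q = length (takeWhile (\<lambda>s. s = North) Q)"

section \<open>The generating function\<close>

text \<open>The variable of the power series is \<open>t\<close>; in its coefficients the inner polynomial
  variable is \<open>x\<close> and the outer one is \<open>y\<close>, so that \<open>monom (monom a c) r\<close> is
  \<open>a x^c y^r\<close>.\<close>

definition tamari_gf :: "nat \<Rightarrow> rat poly poly fps" where
  "tamari_gf m = Abs_fps (\<lambda>n. \<Sum>(P, Q, l)\<in>labelled_intervals m n.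
     monom (monom (1 / fact n) (contacts m P)) (initial_rise Q))"

text \<open>\<open>F(t; x, 1)\<close> and \<open>F(t; 1, 1)\<close>.\<close>

definition tamari_gf_y1 :: "nat \<Rightarrow> rat poly fps" where
  "tamari_gf_y1 m = Abs_fps (\<lambda>n. poly (tamari_gf m $ n) 1)"

definition tamari_gf_x1_y1 :: "nat \<Rightarrow> rat fps" where
  "tamari_gf_x1_y1 m = Abs_fps (\<lambda>n. poly (tamari_gf_y1 m $ n) 1)"

section \<open>Power series in z with polynomial coefficients in u\<close>

text \<open>The ring \<open>\<rat>[u][[z]]\<close> is \<^typ>\<open>rat poly fps\<close>, with \<open>z\<close> being \<^const>\<open>fps_X\<close> and
  \<open>u\<close> being the polynomial \<open>[:0, 1:]\<close>.
  The library's \<^const>\<open>fps_exp\<close> needs coefficients in a field; \<open>exp_z c\<close> is \<open>exp (c z)\<close>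
  for a polynomial \<open>c\<close> in \<open>u\<close>.\<close>

definition exp_z :: "rat poly \<Rightarrow> rat poly fps" where
  "exp_z c = Abs_fps (\<lambda>k. smult (1 / fact k) (c ^ k))"

text \<open>Division by \<open>u\<close>, coefficient by coefficient. It is only used where all coefficients
  are divisible by \<open>u\<close>, see \<open>divide_u_exact\<close> below.\<close>

definition divide_u :: "rat poly fps \<Rightarrow> rat poly fps" where
  "divide_u f = Abs_fps (\<lambda>k. (f $ k) div [:0, 1:])"

lemma divide_u_exact:
  "fps_const [:0, 1:] * divide_u (1 - exp_z [:0, a:]) = 1 - exp_z [:0, a:]"
proof (rule fps_ext)
  fix k
  have "[:0, 1:] dvd (1 - exp_z [:0, a:]) $ k"
  proof (cases k)
    case 0
    then show ?thesis by (simp add: exp_z_def one_pCons)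
  next
    case (Suc j)
    have "[:0, 1:] dvd pCons 0 p" for p :: "rat poly"
      by (rule dvdI[where k = p]) simp
    then show ?thesis
      using Suc by (simp add: exp_z_def)
  qed
  then show "(fps_const [:0, 1:] * divide_u (1 - exp_z [:0, a:])) $ k =
             (1 - exp_z [:0, a:]) $ k"
    by (simp only: fps_mult_left_const_nth divide_u_def fps_nth_Abs_fps dvd_mult_div_cancel)
qed

text \<open>Evaluation of a polynomial in \<open>x\<close> with rational coefficients at a point of
  \<open>\<rat>[u][[z]]\<close>.\<close>

definition eval_x :: "rat poly \<Rightarrow> rat poly fps \<Rightarrow> rat poly fps" where
  "eval_x p X = poly (map_poly (\<lambda>a. fps_const [:a:]) p) X"

text \<open>The substituted series \<open>t = z exp(-m(m+1)z)\<close> and \<open>x = (1+u) exp(-mzu)\<close>.\<close>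

definition t_series :: "nat \<Rightarrow> rat poly fps" where
  "t_series m = fps_X * exp_z [:- of_nat (m * (m + 1)):]"

definition x_series :: "nat \<Rightarrow> rat poly fps" where
  "x_series m = fps_const [:1, 1:] * exp_z [:0, - of_nat m:]"

section \<open>All sums above are finite\<close>

lemma finite_ballot_paths: "finite (ballot_paths m n)"
proof (rule finite_subset)
  have "length P = count_list P North + count_list P East" for P
  proof (induction P)
    case (Cons s P)
    then show ?case by (cases s) auto
  qed simp
  then show "ballot_paths m n \<subseteq> {P. set P \<subseteq> {North, East} \<and> length P = n + m * n}"
    using step.exhaust by (auto simp: ballot_paths_def ballot_path_def)
  show "finite {P. set P \<subseteq> {North, East} \<and> length P = n + m * n}"
    by (rule finite_lists_length_eq) simp
qed

lemma finite_labelled_intervals: "finite (labelled_intervals m n)"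
proof (rule finite_subset)
  show "labelled_intervals m n \<subseteq>
    Sigma (ballot_paths m n) (\<lambda>P. Sigma (ballot_paths m n)
      (\<lambda>Q. north_positions Q \<rightarrow>\<^sub>E {1..n}))"
    by (auto simp: labelled_intervals_def tamari_intervals_def labellings_def)
  show "finite (Sigma (ballot_paths m n) (\<lambda>P. Sigma (ballot_paths m n)
      (\<lambda>Q. north_positions Q \<rightarrow>\<^sub>E {1..n})))"
    by (intro finite_SigmaI finite_ballot_paths finite_PiE)
      (auto simp: north_positions_def)
qed

end

theory Submission
  imports Defs
begin

text \<open>The proof turns the Tamari order into a recursion on pairs of paths, reads off a linear functional
equation for the generating function, and solves it by the kernel method.

Combinatorics. A ballot path is empty or a north step followed by an excursion from level \<open>m\<close> to
level \<open>0\<close>, and an excursion from level \<open>k + 1\<close> is an excursion from level \<open>k\<close>, an east step and a ballot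
path. In the Tamari order a path grows by moving an east step past a prime ballot factor, that is, by
handing material to the part of the path on the left of that east step. Following this through the
decomposition gives the relation \<open>interval_rel\<close>; \<open>tamari_intervals_iff\<close> says that at level \<open>0\<close> it is the
Tamari order. An increasing labelling of the upper path amounts to the weight that has a factor
\<open>1 / r!\<close> for each run of \<open>r\<close> north steps (\<open>card_labellings\<close>). So if \<open>F\<^sub>k\<close> is the part of \<open>F\<close> of initial rise
\<open>k\<close>, then \<open>F\<^sub>0 = x\<close> and
\<open>k F\<^sub>k = t x (F \<Delta>)\<^sup>m F\<^sub>k\<^sub>-\<^sub>1\<close>, where \<open>F\<close> stands for \<open>F(t; x, 1) = F\<^sub>0 + F\<^sub>1 + \<dots>\<close> and \<open>\<Delta> p = (p(x) - p(1)) / (x - 1)\<close>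
comes from the choice of a contact of the lower path
(\<open>interval_gf_0\<close>, \<open>interval_gf_north\<close>, \<open>interval_gf_east\<close>).

Uniqueness. After the substitution, \<open>t\<close> is divisible by \<open>z\<close>. So if \<open>F\<close> agrees with the closed form modulo
\<open>z\<^sup>n\<close>, then replacing the factors \<open>F\<close> of the recursion by the closed form changes the \<open>F\<^sub>k\<close> only modulo
\<open>z\<^sup>n\<^sup>+\<^sup>1\<close>. It remains to see that this linearised recursion, \<open>rise_series\<close>, sums to the closed form
(\<open>rise_total_eq_closed_form\<close>).

Kernel method. The closed form \<open>G\<close> satisfies \<open>G / (x - 1) = v e\<^sup>(\<^sup>m\<^sup>+\<^sup>1\<^sup>)\<^sup>z\<close> with \<open>v = ((1 + u) / u) e\<^sup>z\<^sup>u\<close>, and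
\<open>x v\<^sup>m = (1 + u)\<^sup>m\<^sup>+\<^sup>1 / u\<^sup>m\<close> is free of \<open>z\<close>. Fix a complex number \<open>w\<close> and let \<open>u\<close> run through the \<open>m + 1\<close> roots
\<open>u\<^sub>i\<close> of \<open>(1 + u)\<^sup>m\<^sup>+\<^sup>1 = w u\<^sup>m\<close>, with values \<open>v\<^sub>i\<close> and \<open>x\<^sub>i\<close> of \<open>v\<close> and \<open>x\<close>. The functional
\<open>g \<mapsto> \<Sum>\<^sub>i g(u\<^sub>i) / (x\<^sub>i v\<^sub>i \<Prod>\<^sub>j\<^sub>\<noteq>\<^sub>i (v\<^sub>i - v\<^sub>j))\<close> kills the terms coming from the values at \<open>u = 0\<close>, because
\<open>\<Sum>\<^sub>i v\<^sub>i\<^sup>j / \<Prod> = 0\<close> for \<open>j < m\<close> by Lagrange interpolation; hence one step of the recursion multiplies it by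
\<open>z w / k\<close>, and its value at the sum of the series is \<open>e\<^sup>z\<^sup>w\<close> times that at the first term \<open>x\<close>. Both sides of the claim
therefore have the explicit value \<open>- e\<^sup>(\<^sup>m\<^sup>+\<^sup>1\<^sup>)\<^sup>z / w\<close>. Multiples of \<open>1 + u\<close> that have the same value for all generic \<open>w\<close>
are equal (\<open>kernel_sum_nonzero\<close>).

Finally, \<open>u = 0\<close> gives \<open>F(t; 1, 1)\<close>, and its coefficients follow by Lagrange inversion.\<close>

section \<open>Excursions and the covering relation\<close>

text \<open>Paths that start at height \<open>k\<close>, where a north step raises the height by \<open>m\<close> and an east step lowers it
by \<open>1\<close>, that stay at nonnegative height and end at height \<open>0\<close>. Ballot paths are the case \<open>k = 0\<close>; the other
heights are needed for the tails of ballot paths.\<close>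

fun excursion :: "nat \<Rightarrow> nat \<Rightarrow> step list \<Rightarrow> bool" where
  "excursion m k [] \<longleftrightarrow> k = 0"
| "excursion m k (North # P) \<longleftrightarrow> excursion m (k + m) P"
| "excursion m 0 (East # P) \<longleftrightarrow> False"
| "excursion m (Suc k) (East # P) \<longleftrightarrow> excursion m k P"

abbreviation size_of :: "step list \<Rightarrow> nat" where
  "size_of P \<equiv> count_list P North"

lemma excursion_append:
  "excursion m a A \<Longrightarrow> excursion m (a + k) (A @ B) \<longleftrightarrow> excursion m k B"
proof (induction m a A rule: excursion.induct)
  case (2 m a P)
  then show ?case by (simp add: ac_simps)
qed auto

lemma excursion_append_0:
  "excursion m 0 A \<Longrightarrow> excursion m k (A @ B) \<longleftrightarrow> excursion m k B"
  using excursion_append[of m 0 A k B] by simp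

lemma excursion_append_E:
  "excursion m k P \<Longrightarrow> excursion m (Suc k) (P @ East # A) \<longleftrightarrow> excursion m 0 A"
  using excursion_append[of m k P 1 "East # A"] by simp

lemma excursion_append_same:
  "excursion m k P \<Longrightarrow> excursion m k (P @ A) \<longleftrightarrow> excursion m 0 A"
  using excursion_append[of m k P 0 A] by simp

text \<open>After \<open>C\<close> the height has dropped by \<open>i\<close>, and it may not become negative.\<close>

lemma excursion_prefix_le:
  "excursion m i C \<Longrightarrow> excursion m j (C @ D) \<Longrightarrow> i \<le> j"
proof (induction m i C arbitrary: j rule: excursion.induct)
  case (2 m k P)
  then show ?case using "2.IH"[of "j + m"] by auto
next
  case (4 m k P)
  then show ?case using "4.IH"[of "j - 1"] by (cases j) auto
qed auto

lemma excursion_suffix: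
  "excursion m k (A @ B) \<Longrightarrow> \<exists>i. excursion m i B"
proof (induction m k A rule: excursion.induct)
qed auto

lemma excursion_cong_suffix:
  assumes "\<And>j. excursion m j X \<longleftrightarrow> excursion m j Y"
  shows "excursion m k (A @ X) \<longleftrightarrow> excursion m k (A @ Y)"
  using assms
proof (induction m k A rule: excursion.induct)
qed auto

text \<open>The split is at the first visit to height \<open>0\<close>, which is reached by an east step because there is
no other way down.\<close>

lemma excursion_split_E:
  "excursion m (Suc k) Q \<Longrightarrow> \<exists>P S. Q = P @ East # S \<and> excursion m k P \<and> excursion m 0 S"
proof (induction Q arbitrary: k)
  case (Cons s Q)
  show ?case
  proof (cases s)
    case North
    with Cons.prems have "excursion m (Suc (k + m)) Q" by simp
    from Cons.IH[OF this] obtain P S where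
      "Q = P @ East # S" "excursion m (k + m) P" "excursion m 0 S" by blast
    then show ?thesis
      using North by (intro exI[of _ "North # P"] exI[of _ S]) simp
  next
    case East
    with Cons.prems have Q: "excursion m k Q" by simp
    show ?thesis
    proof (cases k)
      case 0
      then show ?thesis using Q East by (intro exI[of _ "[]"] exI[of _ Q]) simp
    next
      case (Suc k')
      from Cons.IH[of k'] Q Suc obtain P S where
        "Q = P @ East # S" "excursion m k' P" "excursion m 0 S" by blast
      then show ?thesis
        using East Suc by (intro exI[of _ "East # P"] exI[of _ S]) simp
    qed
  qed
qed simp

lemma split_at_equal:
  assumes "X @ e # Y = Z @ e # W"
  shows "(X = Z \<and> Y = W) \<or> (\<exists>C. Z = X @ e # C \<and> Y = C @ e # W) \<or>
         (\<exists>C. X = Z @ e # C \<and> W = C @ e # Y)"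
  using assms
proof (induction X arbitrary: Z)
  case (Cons x X)
  then show ?case by (cases Z) auto
qed (auto simp: Cons_eq_append_conv)

lemma excursion_split_E_unique:
  assumes "P @ East # S = P' @ East # S'" "excursion m k P" "excursion m k P'"
  shows "P = P' \<and> S = S'"
proof -
  from assms(1) consider (1) "P = P' \<and> S = S'" | (2) C where "P = P' @ East # C"
    | (3) C where "P' = P @ East # C"
    using split_at_equal[of P East S P' S'] by blast
  then show ?thesis
  proof cases
    case 2
    then show ?thesis using assms excursion_append_same[of m k P' "East # C"] by simp
  next
    case 3
    then show ?thesis using assms excursion_append_same[of m k P "East # C"] by simp
  qed simp
qed

lemma excursion_counts:
  "excursion m k P \<Longrightarrow> count_list P East = k + m * size_of P"
proof (induction m k P rule: excursion.induct)
  case (2 m k P)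
  then show ?case by simp
qed auto

lemma all_nat_cases: "(\<forall>i::nat. \<phi> i) \<longleftrightarrow> \<phi> 0 \<and> (\<forall>i. \<phi> (Suc i))"
  by (metis not0_implies_Suc)

lemma excursion_iff:
  "excursion m k P \<longleftrightarrow> count_list P East = k + m * size_of P \<and>
     (\<forall>i. count_list (take i P) East \<le> k + m * size_of (take i P))"
proof (induction m k P rule: excursion.induct)
  case (2 m k P)
  show ?case by (subst all_nat_cases) (simp add: 2 ac_simps)
next
  case (3 m P)
  have "\<not> count_list (take 1 (East # P)) East \<le> 0 + m * size_of (take 1 (East # P))"
    by simp
  then show ?case using excursion.simps(3) by blast
next
  case (4 m k P)
  show ?case by (subst all_nat_cases) (simp add: 4)
qed auto

lemma ballot_path_iff:
  "ballot_path m n P \<longleftrightarrow> excursion m 0 P \<and> size_of P = n"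
proof -
  have "(\<forall>i\<le>length P. count_list (take i P) East \<le> m * size_of (take i P)) \<longleftrightarrow>
    (\<forall>i. count_list (take i P) East \<le> m * size_of (take i P))"
    by (metis nat_le_linear order_refl take_all)
  then show ?thesis by (auto simp: ballot_path_def excursion_iff)
qed

definition prime_excursion :: "nat \<Rightarrow> step list \<Rightarrow> bool" where
  "prime_excursion m S \<longleftrightarrow> S \<noteq> [] \<and> excursion m 0 S \<and>
     (\<forall>X Y. S = X @ Y \<longrightarrow> X \<noteq> [] \<longrightarrow> excursion m 0 X \<longrightarrow> Y = [])"

text \<open>The minimality of the moved factor \<open>S\<close> involves only prefixes of \<open>S\<close>, and so does not refer to the rest
of the path.\<close>

lemma tamari_cover_iff:
  "tamari_cover m P Q \<longleftrightarrow>
     (\<exists>A S B. P = A @ East # S @ B \<and> Q = A @ S @ East # B \<and> prime_excursion m S)"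
  (is "?l = ?r")
proof
  assume ?l
  then obtain A S B j where *: "P = A @ [East] @ S @ B" "Q = A @ S @ [East] @ B" "S \<noteq> []"
    "ballot_path m j S" and
    min: "\<And>S' B'. S @ B = S' @ B' \<Longrightarrow> S' \<noteq> [] \<Longrightarrow> \<exists>j. ballot_path m j S' \<Longrightarrow>
      length S \<le> length S'"
    unfolding tamari_cover_def by blast
  have "prime_excursion m S"
    unfolding prime_excursion_def
  proof (intro conjI allI impI)
    fix X Y assume "S = X @ Y" "X \<noteq> []" "excursion m 0 X"
    with min[of X "Y @ B"] show "Y = []" by (auto simp: ballot_path_iff)
  qed (use * in \<open>auto simp: ballot_path_iff\<close>)
  then show ?r using * by auto
next
  assume ?r
  then obtain A S B where *: "P = A @ East # S @ B" "Q = A @ S @ East # B" "prime_excursion m S"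
    by blast
  have "hd S = North"
    using *(3) by (cases "(m, 0::nat, S)" rule: excursion.cases) (auto simp: prime_excursion_def)
  moreover have "length S \<le> length S'" if "S @ B = S' @ B'" "S' \<noteq> []" "ballot_path m j S'" for S' B' j
  proof (rule ccontr)
    assume "\<not> length S \<le> length S'"
    with that(1) obtain Y where "S = S' @ Y" "Y \<noteq> []"
      by (auto simp: append_eq_append_conv2)
    with that *(3) show False by (auto simp: prime_excursion_def ballot_path_iff)
  qed
  moreover have "\<exists>j. ballot_path m j S" "S \<noteq> []"
    using *(3) by (auto simp: prime_excursion_def ballot_path_iff)
  ultimately show ?l
    unfolding tamari_cover_def using *(1,2) by (intro exI[of _ A] exI[of _ S] exI[of _ B]) auto
qed

lemma prime_prefix_exists:
  assumes "excursion m 0 A" "A \<noteq> []"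
  shows "\<exists>S B. A = S @ B \<and> prime_excursion m S \<and> excursion m 0 B"
proof -
  define i where "i = (LEAST i. i > 0 \<and> i \<le> length A \<and> excursion m 0 (take i A))"
  have ex: "length A > 0 \<and> length A \<le> length A \<and> excursion m 0 (take (length A) A)"
    using assms by simp
  from LeastI[of "\<lambda>i. i > 0 \<and> i \<le> length A \<and> excursion m 0 (take i A)", OF ex]
  have i: "i > 0" "i \<le> length A" "excursion m 0 (take i A)" by (auto simp: i_def)
  have min: "i \<le> j" if "j > 0" "j \<le> length A" "excursion m 0 (take j A)" for j
    unfolding i_def using that by (intro Least_le) auto
  have "prime_excursion m (take i A)"
    unfolding prime_excursion_def
  proof (intro conjI allI impI)
    fix X Y assume XY: "take i A = X @ Y" "X \<noteq> []" "excursion m 0 X"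
    have "length X + length Y = i" using arg_cong[OF XY(1), of length] i(2) by simp
    moreover have "take (length X) A = X"
      using arg_cong[OF XY(1), of "take (length X)"] calculation by (simp add: min_def split: if_splits)
    ultimately have "i \<le> length X" using XY i(2) by (intro min) auto
    with \<open>length X + length Y = i\<close> have "length Y = 0" by linarith
    then show "Y = []" by simp
  qed (use i in auto)
  moreover have "excursion m 0 (drop i A)"
    using excursion_append_same[OF i(3), of "drop i A"] assms by simp
  ultimately show ?thesis by (metis append_take_drop_id)
qed

lemma tamari_cover_context:
  "tamari_cover m P Q \<Longrightarrow> tamari_cover m (C @ P @ D) (C @ Q @ D)"
  unfolding tamari_cover_iff
  by (metis append.assoc append_Cons)

lemma tamari_le_context:
  "tamari_le m P Q \<Longrightarrow> tamari_le m (C @ P @ D) (C @ Q @ D)"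
  unfolding tamari_le_def
  by (induction rule: rtranclp_induct) (auto intro: rtranclp.rtrancl_into_rtrancl tamari_cover_context)

lemma tamari_le_trans [trans]: "tamari_le m P Q \<Longrightarrow> tamari_le m Q R \<Longrightarrow> tamari_le m P R"
  unfolding tamari_le_def by (rule rtranclp_trans)

text \<open>A ballot path is a product of prime ones, and the east step passes them one at a time.\<close>

lemma tamari_le_move_east:
  "excursion m 0 A \<Longrightarrow> tamari_le m (East # A) (A @ [East])"
proof (induction A rule: length_induct)
  case (1 A)
  show ?case
  proof (cases "A = []")
    case False
    from prime_prefix_exists[OF "1.prems" this] obtain S B where
      *: "A = S @ B" "prime_excursion m S" "excursion m 0 B" by blast
    from * have "S \<noteq> []" by (simp add: prime_excursion_def)
    with * "1.IH" have IH: "tamari_le m (East # B) (B @ [East])" by simp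
    have "tamari_cover m (East # S @ B) (S @ East # B)"
      unfolding tamari_cover_iff using *(2) by (intro exI[of _ "[]"] exI[of _ S] exI[of _ B]) simp
    then have "tamari_le m (East # A) (S @ East # B)" by (simp add: tamari_le_def *)
    also have "tamari_le m (S @ East # B) (S @ B @ [East])"
      using tamari_le_context[OF IH, of S "[]"] by simp
    finally show ?thesis using * by simp
  qed (simp add: tamari_le_def)
qed

section \<open>A recursive description of Tamari intervals\<close>

text \<open>Pairs \<open>(P, Q)\<close> of excursions from level \<open>k\<close> with \<open>P\<close> below \<open>Q\<close>. In the last rule the lower
path of a pair at level \<open>k\<close> ends with a ballot path \<open>A\<close>, which starts at one of its visits to height
\<open>0\<close>. The new east step comes before \<open>A\<close> in the lower path, but after everything of level \<open>k\<close> in the upper one: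
this is the slack that moving an east step to the right can create.\<close>

inductive interval_rel :: "nat \<Rightarrow> nat \<Rightarrow> step list \<Rightarrow> step list \<Rightarrow> bool" for m where
  empty: "interval_rel m 0 [] []"
| north: "interval_rel m m P Q \<Longrightarrow> interval_rel m 0 (North # P) (North # Q)"
| east: "interval_rel m k (P @ A) Q \<Longrightarrow> excursion m k P \<Longrightarrow> excursion m 0 A \<Longrightarrow>
    interval_rel m 0 R S \<Longrightarrow> interval_rel m (Suc k) (P @ East # A @ R) (Q @ East # S)"

lemma interval_rel_excursion:
  "interval_rel m k P Q \<Longrightarrow> excursion m k P \<and> excursion m k Q \<and> size_of P = size_of Q"
  by (induction rule: interval_rel.induct)
    (auto simp: excursion_append_E excursion_append_0)

text \<open>In the last rule, first move the east step past \<open>A\<close>; then the two parts on either side of it can be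
raised independently.\<close>

lemma interval_rel_imp_le: "interval_rel m k P Q \<Longrightarrow> tamari_le m P Q"
proof (induction rule: interval_rel.induct)
  case (north P Q)
  then show ?case using tamari_le_context[of m P Q "[North]" "[]"] by simp
next
  case (east k P A Q R S)
  have "tamari_le m (P @ East # A @ R) (P @ A @ East # R)"
    using tamari_le_context[OF tamari_le_move_east[OF east.hyps(3)], of P R] by simp
  also have "tamari_le m (P @ A @ East # R) (Q @ East # R)"
    using tamari_le_context[OF east.IH(1), of "[]" "East # R"] by simp
  also have "tamari_le m (Q @ East # R) (Q @ East # S)"
    using tamari_le_context[OF east.IH(2), of "Q @ [East]" "[]"] by simp
  finally show ?case .
qed (simp add: tamari_le_def)

lemma interval_rel_refl: "excursion m k P \<Longrightarrow> interval_rel m k P P"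
proof (induction P arbitrary: k rule: length_induct)
  case (1 P)
  show ?case
  proof (cases k)
    case (Suc k')
    with excursion_split_E[of m k' P] "1.prems" obtain Q S where
      "P = Q @ East # S" "excursion m k' Q" "excursion m 0 S" by blast
    then show ?thesis using "1.IH" Suc interval_rel.east[of m k' Q "[]" Q S S] by simp
  next
    case 0
    show ?thesis
    proof (cases P)
      case (Cons s P')
      then show ?thesis using 0 1 by (cases s) (auto intro: interval_rel.north)
    qed (use 0 interval_rel.empty in simp)
  qed
qed

lemma excursion_unswap:
  assumes "excursion m 0 S"
  shows "excursion m k (C @ East # S @ D) \<longleftrightarrow> excursion m k (C @ S @ East # D)"
proof (rule excursion_cong_suffix)
  fix j show "excursion m j (East # S @ D) \<longleftrightarrow> excursion m j (S @ East # D)"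
    using assms by (cases j) (simp_all add: excursion_append_0)
qed

text \<open>A ballot factor ends at its lowest height. So if it starts before a contact, it cannot end strictly
above the height of that contact; this prevents a covering swap from affecting both sides of a contact.\<close>

lemma excursion_straddle:
  assumes "excursion m 0 (U @ D)" "excursion m 0 (D @ East # B)"
  shows False
proof -
  from excursion_suffix[OF assms(1)] obtain i where i: "excursion m i D" by blast
  from excursion_prefix_le[OF this assms(2)] have "i = 0" by simp
  with i excursion_append_0[of m D 0 "East # B"] assms show False by simp
qed

text \<open>In the last rule, the swapped east step of the smaller path is the distinguished one, or lies in one of
the three factors \<open>P\<close>, \<open>A\<close> and \<open>R\<close>. In the first case the factor that it jumped over is added to \<open>A\<close>. In
the others the swap happens inside \<open>P @ A\<close> or inside \<open>R\<close>, by \<open>excursion_straddle\<close>, and the induction hypothesis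
applies.\<close>

lemma tamari_cover_interval_rel:
  "interval_rel m k P' Q \<Longrightarrow> tamari_cover m P P' \<Longrightarrow> interval_rel m k P Q"
proof (induction k P' Q arbitrary: P rule: interval_rel.induct)
  case empty
  then show ?case by (auto simp: tamari_cover_iff)
next
  case (north P' Q)
  from north.prems obtain A S B where *: "P = A @ East # S @ B" "North # P' = A @ S @ East # B"
    "prime_excursion m S" by (auto simp: tamari_cover_iff)
  have S: "excursion m 0 S" using *(3) by (simp add: prime_excursion_def)
  have "A \<noteq> []"
  proof
    assume "A = []"
    with interval_rel_excursion[OF north.hyps] * S excursion_append_0[OF S, of 0 "East # B"]
    show False by (metis add_0 append_Nil excursion.simps(2,3))
  qed
  with * obtain A' where A': "A = North # A'" "P' = A' @ S @ East # B" by (cases A) auto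
  have "tamari_cover m (A' @ East # S @ B) P'" using A' *(3) by (auto simp: tamari_cover_iff)
  from north.IH[OF this] show ?case using * A' by (auto intro: interval_rel.north)
next
  case (east k P0 A1 Q R T)
  from east.prems obtain A S B where *: "P = A @ East # S @ B"
    "P0 @ East # A1 @ R = A @ S @ East # B"
    "prime_excursion m S" by (auto simp: tamari_cover_iff)
  have S: "excursion m 0 S" using *(3) by (simp add: prime_excursion_def)
  have R: "excursion m 0 R" using interval_rel_excursion[OF east.hyps(4)] by blast
  have A1R: "excursion m 0 (A1 @ R)" using east.hyps(3) R by (simp add: excursion_append_0)
  from *(2) consider (a) "P0 = A @ S" "B = A1 @ R"
    | (b) C where "P0 = A @ S @ East # C" "B = C @ East # A1 @ R"
    | (c) C where "A @ S = P0 @ East # C" "A1 @ R = C @ East # B"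
    using split_at_equal[of P0 East "A1 @ R" "A @ S" B]
    by (auto simp: append_eq_append_conv2[of A S P0] append_eq_Cons_conv)
  then show ?case
  proof cases
    case a
    have "interval_rel m (Suc k) (A @ East # (S @ A1) @ R) (Q @ East # T)"
    proof (rule interval_rel.east)
      show "interval_rel m k (A @ S @ A1) Q" using east.hyps(1) a by simp
      show "excursion m k A" using east.hyps(2) a S
        using excursion_cong_suffix[of m S "[]" k A] excursion_append_0[OF S, of _ "[]"] by simp
      show "excursion m 0 (S @ A1)" using S east.hyps(3) by (simp add: excursion_append_0)
    qed fact
    then show ?thesis using * a by simp
  next
    case b
    have "interval_rel m (Suc k) ((A @ East # S @ C) @ East # A1 @ R) (Q @ East # T)"
    proof (rule interval_rel.east)
      show "interval_rel m k ((A @ East # S @ C) @ A1) Q"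
        using b *(3) by (intro east.IH) (auto simp: tamari_cover_iff)
      show "excursion m k (A @ East # S @ C)"
        using b east.hyps(2) S by (simp add: excursion_unswap)
    qed fact+
    then show ?thesis using * b by simp
  next
    case c
    obtain C' where C': "C = C' @ S" "A = P0 @ East # C'"
    proof -
      from c(1) have "A @ S = (P0 @ [East]) @ C" by simp
      then consider us where "A = P0 @ [East] @ us" "us @ S = C"
        | us where "A @ us = P0 @ [East]" "S = us @ C"
        unfolding append_eq_append_conv2 by auto
      then show ?thesis
      proof cases
        case (2 us)
        have False using excursion_straddle[of m us C B] 2 S A1R c(2) by simp
        then show ?thesis ..
      qed (use that in auto)
    qed
    from c(2) consider (d) D where "A1 = C @ East # D" "B = D @ R"
      | (e) D where "C = A1 @ D" "R = D @ East # B"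
    proof -
      from c(2) consider us where "A1 = C @ us" "us @ R = East # B"
        | us where "A1 @ us = C" "R = us @ East # B"
        unfolding append_eq_append_conv2 by auto
      then show ?thesis
      proof cases
        case (1 us)
        then show ?thesis using d e[of "[]"] by (cases us) auto
      qed (use e in auto)
    qed
    then show ?thesis
    proof cases
      case d
      have "interval_rel m (Suc k) (P0 @ East # (C' @ East # S @ D) @ R) (Q @ East # T)"
      proof (rule interval_rel.east)
        show "interval_rel m k (P0 @ C' @ East # S @ D) Q"
        proof (rule east.IH)
          show "tamari_cover m (P0 @ C' @ East # S @ D) (P0 @ A1)"
            unfolding tamari_cover_iff using *(3) C' d
            by (intro exI[of _ "P0 @ C'"] exI[of _ S] exI[of _ D]) simp
        qed
        show "excursion m 0 (C' @ East # S @ D)"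
          using d C' east.hyps(3) S by (simp add: excursion_unswap)
      qed fact+
      then show ?thesis using * c C' d by simp
    next
      case e
      obtain D' where D': "D = D' @ S" "C' = A1 @ D'"
      proof -
        from e(1) C' have "C' @ S = A1 @ D" by simp
        then consider us where "C' = A1 @ us" "us @ S = D"
          | us where "C' @ us = A1" "S = us @ D"
          unfolding append_eq_append_conv2 by auto
        then show ?thesis
        proof cases
          case (2 us)
          have False using excursion_straddle[of m us D B] 2 S R e(2) by simp
          then show ?thesis ..
        qed (use that in auto)
      qed
      have "interval_rel m (Suc k) (P0 @ East # A1 @ (D' @ East # S @ B)) (Q @ East # T)"
      proof (rule interval_rel.east)
        show "interval_rel m 0 (D' @ East # S @ B) T"
        proof (rule east.IH)
          show "tamari_cover m (D' @ East # S @ B) R"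
            unfolding tamari_cover_iff using *(3) D' e
            by (intro exI[of _ D'] exI[of _ S] exI[of _ B]) simp
        qed
      qed fact+
      then show ?thesis using * c C' D' e by simp
    qed
  qed
qed

theorem tamari_intervals_iff:
  "(P, Q) \<in> tamari_intervals m n \<longleftrightarrow> interval_rel m 0 P Q \<and> size_of Q = n"
proof
  assume "(P, Q) \<in> tamari_intervals m n"
  then have *: "ballot_path m n Q" "tamari_le m P Q"
    by (auto simp: tamari_intervals_def ballot_paths_def)
  from *(2)[unfolded tamari_le_def] have "interval_rel m 0 P Q"
  proof (induction rule: converse_rtranclp_induct)
    case base
    show ?case using * by (intro interval_rel_refl) (simp add: ballot_path_iff)
  qed (rule tamari_cover_interval_rel)
  then show "interval_rel m 0 P Q \<and> size_of Q = n" using * by (simp add: ballot_path_iff)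
next
  assume *: "interval_rel m 0 P Q \<and> size_of Q = n"
  then show "(P, Q) \<in> tamari_intervals m n"
    using interval_rel_imp_le[of m 0 P Q] interval_rel_excursion[of m 0 P Q]
    by (auto simp: tamari_intervals_def ballot_paths_def ballot_path_iff)
qed

section \<open>Counting the labellings of a path\<close>

text \<open>The set of labels is arbitrary because the labels that remain after the first run need not be
consecutive.\<close>

definition labellings_by :: "nat set \<Rightarrow> step list \<Rightarrow> (nat \<Rightarrow> nat) set" where
  "labellings_by L Q =
     {l \<in> north_positions Q \<rightarrow>\<^sub>E L.
        bij_betw l (north_positions Q) L \<and>
        (\<forall>i j. i < j \<and> {i..j} \<subseteq> north_positions Q \<longrightarrow> l i < l j)}"

text \<open>The product of \<open>1 / r!\<close> over the maximal runs of \<open>r\<close> north steps: prepending a north step to a run of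
length \<open>r\<close> replaces \<open>1 / r!\<close> by \<open>1 / (r + 1)!\<close>.\<close>

fun weight :: "step list \<Rightarrow> rat" where
  "weight [] = 1"
| "weight (East # Q) = weight Q"
| "weight (North # Q) = weight Q / of_nat (Suc (initial_rise Q))"

lemma initial_rise_simps [simp]:
  "initial_rise [] = 0" "initial_rise (East # Q) = 0"
  "initial_rise (North # Q) = Suc (initial_rise Q)"
  by (simp_all add: initial_rise_def)

lemma initial_rise_append_East [simp]: "initial_rise (Q @ East # S) = initial_rise Q"
  by (induction Q rule: weight.induct) simp_all

lemma weight_append_East [simp]: "weight (Q @ East # S) = weight Q * weight S"
  by (induction Q rule: weight.induct) simp_all

lemma initial_rise_run [simp]: "initial_rise (replicate r North) = r"
  by (induction r) simp_all

lemma weight_run [simp]: "weight (replicate r North) = 1 / fact r"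
  by (induction r) (simp_all add: divide_simps)

lemma finite_north_positions [simp]: "finite (north_positions Q)"
  by (simp add: north_positions_def)

lemma north_positions_run:
  "p \<in> north_positions (replicate r North @ East # Q) \<longleftrightarrow>
     p < r \<or> (p > r \<and> p - Suc r \<in> north_positions Q)"
  by (auto simp: north_positions_def nth_append nth_Cons' not_less less_diff_conv split: if_splits)

text \<open>A labelling is determined by the set of labels on the first run, on which it has to be the
increasing enumeration, and by its restriction to the remaining path, moved to the origin.\<close>

lemma labellings_by_run_bij:
  fixes L :: "nat set" and Q :: "step list" and r :: nat
  assumes "finite L"
  defines "f \<equiv> (\<lambda>l. (l ` {..<r}, restrict (\<lambda>p. l (p + Suc r)) (north_positions Q)))"
    and "g \<equiv> (\<lambda>(K, l :: nat \<Rightarrow> nat). restrict (\<lambda>p. if p < r then sorted_list_of_set (K :: nat set) ! p else l (p - Suc r))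
               (north_positions (replicate r North @ East # Q)))"
  shows "bij_betw f (labellings_by L (replicate r North @ East # Q))
           (SIGMA K : {K. K \<subseteq> L \<and> card K = r}. labellings_by (L - K) Q)"
proof (rule bij_betwI[of f _ _ g])
  let ?Q = "replicate r North @ East # Q"
  let ?N = "north_positions ?Q"
  have N: "p \<in> ?N \<longleftrightarrow> p < r \<or> (p > r \<and> p - Suc r \<in> north_positions Q)" for p
    by (rule north_positions_run)
  have Neq: "?N = {..<r} \<union> (\<lambda>p. p + Suc r) ` north_positions Q"
  proof (intro set_eqI)
    fix p
    have "p - Suc r + Suc r = p" if "r < p" using that by simp
    then show "p \<in> ?N \<longleftrightarrow> p \<in> {..<r} \<union> (\<lambda>p. p + Suc r) ` north_positions Q"
      unfolding N by (auto simp: image_iff intro: bexI[of _ "p - Suc r"])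
  qed
  have tail_sub: "{i..j} \<subseteq> north_positions Q \<longleftrightarrow> {i + Suc r..j + Suc r} \<subseteq> ?N" for i j
  proof
    assume *: "{i..j} \<subseteq> north_positions Q"
    show "{i + Suc r..j + Suc r} \<subseteq> ?N"
    proof
      fix p assume "p \<in> {i + Suc r..j + Suc r}"
      then have "p - Suc r \<in> {i..j}" "p > r" by auto
      with * show "p \<in> ?N" by (auto simp: N)
    qed
  next
    assume *: "{i + Suc r..j + Suc r} \<subseteq> ?N"
    show "{i..j} \<subseteq> north_positions Q"
    proof
      fix p assume "p \<in> {i..j}"
      then have "p + Suc r \<in> ?N" using * by auto
      then show "p \<in> north_positions Q" by (auto simp: N)
    qed
  qed
  show "f \<in> labellings_by L ?Q \<rightarrow> (SIGMA K : {K. K \<subseteq> L \<and> card K = r}. labellings_by (L - K) Q)"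
  proof
    fix l assume l: "l \<in> labellings_by L ?Q"
    have bij: "bij_betw l ?N L" using l by (simp add: labellings_by_def)
    then have inj: "inj_on l ?N" and im: "l ` ?N = L" by (auto simp: bij_betw_def)
    have K: "l ` {..<r} \<subseteq> L" using im by (auto simp: Neq)
    have "inj_on l {..<r}" using inj by (rule inj_on_subset) (auto simp: Neq)
    then have cK: "card (l ` {..<r}) = r" by (simp add: card_image)
    have "L - l ` {..<r} = (\<lambda>p. l (p + Suc r)) ` north_positions Q"
    proof -
      have "l ` {..<r} \<inter> l ` ((\<lambda>p. p + Suc r) ` north_positions Q) =
          l ` ({..<r} \<inter> ((\<lambda>p. p + Suc r) ` north_positions Q))"
        using inj by (subst inj_on_image_Int[of l ?N]) (auto simp: Neq)
      also have "{..<r} \<inter> ((\<lambda>p. p + Suc r) ` north_positions Q) = {}" by auto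
      finally show ?thesis unfolding im[symmetric] Neq by (auto simp: image_Un image_image)
    qed
    moreover have "inj_on (\<lambda>p. l (p + Suc r)) (north_positions Q)"
      by (rule inj_onI) (auto dest!: inj_onD[OF inj] simp: N)
    ultimately have bij': "bij_betw (\<lambda>p. l (p + Suc r)) (north_positions Q) (L - l ` {..<r})"
      by (simp add: bij_betw_def)
    have "restrict (\<lambda>p. l (p + Suc r)) (north_positions Q) \<in> labellings_by (L - l ` {..<r}) Q"
      unfolding labellings_by_def
    proof (intro CollectI conjI allI impI)
      show "bij_betw (restrict (\<lambda>p. l (p + Suc r)) (north_positions Q)) (north_positions Q)
          (L - l ` {..<r})" using bij' by simp
      show "restrict (\<lambda>p. l (p + Suc r)) (north_positions Q) \<in> north_positions Q \<rightarrow>\<^sub>E L - l ` {..<r}"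
        using bij_betw_imp_funcset[OF bij'] by (auto simp: PiE_def)
      fix i j assume ij: "i < j \<and> {i..j} \<subseteq> north_positions Q"
      then have "l (i + Suc r) < l (j + Suc r)"
        using l tail_sub[of i j] unfolding labellings_by_def by auto
      moreover have "i \<in> north_positions Q" "j \<in> north_positions Q" using ij by auto
      ultimately show "restrict (\<lambda>p. l (p + Suc r)) (north_positions Q) i
        < restrict (\<lambda>p. l (p + Suc r)) (north_positions Q) j" by simp
    qed
    then show "f l \<in> (SIGMA K : {K. K \<subseteq> L \<and> card K = r}. labellings_by (L - K) Q)"
      using K cK by (simp add: f_def)
  qed
  have slK: "length (sorted_list_of_set K) = r" "set (sorted_list_of_set K) = K"
     "sorted_wrt (<) (sorted_list_of_set K)" "(\<lambda>p. sorted_list_of_set K ! p) ` {..<r} = K"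
    if "K \<subseteq> L" "card K = r" for K
  proof -
    have fK: "finite K" using that assms finite_subset by blast
    show 1: "length (sorted_list_of_set K) = r" "set (sorted_list_of_set K) = K"
      "sorted_wrt (<) (sorted_list_of_set K)" using fK that by simp_all
    have "(\<lambda>p. sorted_list_of_set K ! p) ` {..<r} = set (sorted_list_of_set K)"
      using 1(1) by (auto simp: set_conv_nth)
    then show "(\<lambda>p. sorted_list_of_set K ! p) ` {..<r} = K" using 1 by simp
  qed
  have g_low: "g (K, l) p = sorted_list_of_set K ! p" if "p < r" for K l p
    using that by (simp add: g_def N)
  have g_high: "g (K, l) (p + Suc r) = l p" if "p \<in> north_positions Q" for K l p
    using that by (simp add: g_def N)
  have g_im_low: "g (K, l) ` {..<r} = K" if "K \<subseteq> L" "card K = r" for K l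
    using slK(4)[OF that] g_low[of _ K l] by (metis (mono_tags, lifting) image_cong lessThan_iff)
  show "g \<in> (SIGMA K : {K. K \<subseteq> L \<and> card K = r}. labellings_by (L - K) Q) \<rightarrow> labellings_by L ?Q"
  proof (rule Pi_I, clarify)
    fix K l assume K: "K \<subseteq> L" "r = card K" and l: "l \<in> labellings_by (L - K) Q"
    have bij: "bij_betw l (north_positions Q) (L - K)"
      using l by (simp add: labellings_by_def)
    have low: "bij_betw (g (K, l)) {..<r} K"
      unfolding bij_betw_def using g_im_low[of K l] K
      by (intro conjI eq_card_imp_inj_on) simp_all
    have "bij_betw (g (K, l)) ((\<lambda>p. p + Suc r) ` north_positions Q) (L - K)"
    proof -
      have "bij_betw (\<lambda>p. g (K, l) (p + Suc r)) (north_positions Q) (L - K)"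
        using bij g_high[of _ K l]
        by (subst bij_betw_cong[of "north_positions Q" _ l]) auto
      moreover have "bij_betw (\<lambda>p. p + Suc r) (north_positions Q) ((\<lambda>p. p + Suc r) ` north_positions Q)"
        by (rule inj_on_imp_bij_betw) (simp add: inj_on_def)
      ultimately show ?thesis
        using bij_betw_comp_iff[of "\<lambda>p. p + Suc r" "north_positions Q" _ "g (K, l)" "L - K"]
        unfolding comp_def by blast
    qed
    from bij_betw_combine[OF low this]
    have "bij_betw (g (K, l)) ?N (K \<union> (L - K))" unfolding Neq by blast
    moreover have "K \<union> (L - K) = L" using K(1) by blast
    ultimately have bijg: "bij_betw (g (K, l)) ?N L" by simp
    have incr: "g (K, l) i < g (K, l) j" if "i < j" "{i..j} \<subseteq> ?N" for i j
    proof (cases "j < r")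
      case True
      then show ?thesis using that g_low[of _ K l] slK(1,3)[of K] K
        by (auto simp: sorted_wrt_iff_nth_less)
    next
      case False
      have "\<not> i \<le> r"
      proof
        assume "i \<le> r"
        with False have "r \<in> {i..j}" by simp
        with that(2) show False by (auto simp: N)
      qed
      then have "i = (i - Suc r) + Suc r" "j = (j - Suc r) + Suc r" using that(1) by simp_all
      then obtain i' j' where i': "i = i' + Suc r" and j': "j = j' + Suc r" by blast
      have sub: "{i'..j'} \<subseteq> north_positions Q" using that tail_sub[of i' j'] i' j' by simp
      then have mem: "i' \<in> north_positions Q" "j' \<in> north_positions Q" using that i' j' by auto
      have "l i' < l j'" using l sub that(1) i' j' unfolding labellings_by_def by auto
      then show ?thesis unfolding i' j' g_high[OF mem(1)] g_high[OF mem(2)] .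
    qed
    have "g (K, l) \<in> extensional ?N" by (simp add: g_def)
    then have "g (K, l) \<in> ?N \<rightarrow>\<^sub>E L"
      using bij_betw_imp_funcset[OF bijg] unfolding PiE_def by blast
    then show "g (K, l) \<in> labellings_by L (replicate (card K) North @ East # Q)"
      unfolding labellings_by_def K(2)[symmetric] using bijg incr by blast
  qed
  show "g (f l) = l" if l: "l \<in> labellings_by L ?Q" for l
  proof
    fix p
    have ext: "l \<in> extensional ?N" using l by (simp add: labellings_by_def PiE_def)
    have incr: "l i < l j" if "i < j" "j < r" for i j
      using l that unfolding labellings_by_def by (auto simp: subset_iff N)
    have "sorted_wrt (<) (map l [0..<r])" by (simp add: sorted_wrt_iff_nth_less incr)
    then have "sorted_list_of_set (set (map l [0..<r])) = map l [0..<r]"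
      by (intro sorted_list_of_set.idem_if_sorted_distinct) (auto simp: strict_sorted_iff)
    then have sl: "sorted_list_of_set (l ` {..<r}) = map l [0..<r]"
      by (simp add: atLeast0LessThan)
    show "g (f l) p = l p"
    proof (cases "p \<in> ?N")
      case True
      then consider "p < r" | "p > r" "p - Suc r \<in> north_positions Q" by (auto simp: N)
      then show ?thesis
      proof cases
        case 1
        then show ?thesis using sl by (simp add: f_def g_low)
      next
        case 2
        then show ?thesis using g_high[of "p - Suc r"] by (simp add: f_def)
      qed
    next
      case False
      then show ?thesis using ext by (simp add: g_def f_def extensional_def)
    qed
  qed
  show "f (g y) = y" if "y \<in> (SIGMA K : {K. K \<subseteq> L \<and> card K = r}. labellings_by (L - K) Q)" for y
  proof -
    obtain K l where y: "y = (K, l)" by (cases y)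
    have K: "K \<subseteq> L" "card K = r" and l: "l \<in> labellings_by (L - K) Q" using that y by auto
    have "restrict (\<lambda>p. g (K, l) (p + Suc r)) (north_positions Q) = l"
    proof
      fix p show "restrict (\<lambda>p. g (K, l) (p + Suc r)) (north_positions Q) p = l p"
        using l g_high[of p K l] by (cases "p \<in> north_positions Q")
          (auto simp: labellings_by_def PiE_def extensional_def)
    qed
    then show ?thesis using y g_im_low[OF K] by (simp add: f_def)
  qed
qed

text \<open>There are \<open>card L choose r\<close> sets of labels for the first run. The east step that closes every run makes
all the runs look alike; \<open>runs_exist\<close> adds the one that is missing at the end of a path.\<close>

lemma card_labellings_by_runs:
  assumes "finite L" "card L = size_of (concat (map (\<lambda>r. replicate r North @ [East]) rs))"
  shows "of_nat (card (labellings_by L (concat (map (\<lambda>r. replicate r North @ [East]) rs)))) =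
    fact (card L) * weight (concat (map (\<lambda>r. replicate r North @ [East]) rs))"
  using assms
proof (induction rs arbitrary: L)
  case Nil
  then have "labellings_by L [] = {\<lambda>_. undefined}"
    by (auto simp: labellings_by_def north_positions_def bij_betw_def)
  then show ?case using Nil by simp
next
  case (Cons r rs)
  define Q where "Q = concat (map (\<lambda>r. replicate r North @ [East]) rs)"
  have Q: "concat (map (\<lambda>r. replicate r North @ [East]) (r # rs)) = replicate r North @ East # Q"
    by (simp add: Q_def)
  have szr: "size_of (replicate r North) = r" by (induction r) simp_all
  have cL: "card L = r + size_of Q" using Cons.prems szr unfolding Q by simp
  have "card (labellings_by L (replicate r North @ East # Q)) =
      card (SIGMA K : {K. K \<subseteq> L \<and> card K = r}. labellings_by (L - K) Q)"
    by (rule bij_betw_same_card[OF labellings_by_run_bij]) fact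
  also have "\<dots> = (\<Sum>K | K \<subseteq> L \<and> card K = r. card (labellings_by (L - K) Q))"
  proof (rule card_SigmaI)
    show "finite {K. K \<subseteq> L \<and> card K = r}" using Cons.prems by simp
    have "finite (labellings_by (L - K) Q)" for K
      unfolding labellings_by_def using Cons.prems
      by (intro finite_Collect_conjI disjI1) (simp add: finite_PiE)
    then show "\<forall>K\<in>{K. K \<subseteq> L \<and> card K = r}. finite (labellings_by (L - K) Q)" by blast
  qed
  finally have "rat_of_nat (card (labellings_by L (replicate r North @ East # Q))) =
      (\<Sum>K | K \<subseteq> L \<and> card K = r. of_nat (card (labellings_by (L - K) Q)))" by simp
  also have "\<dots> = (\<Sum>K | K \<subseteq> L \<and> card K = r. fact (size_of Q) * weight Q)"
  proof (rule sum.cong[OF refl])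
    fix K assume "K \<in> {K. K \<subseteq> L \<and> card K = r}"
    then have "card (L - K) = size_of Q" using cL Cons.prems(1)
      by (auto simp: card_Diff_subset finite_subset)
    with Cons.IH[of "L - K"] Cons.prems(1)
    show "rat_of_nat (card (labellings_by (L - K) Q)) = fact (size_of Q) * weight Q"
      unfolding Q_def by simp
  qed
  also have "\<dots> = of_nat (card L choose r) * (fact (size_of Q) * weight Q)"
    using n_subsets[OF Cons.prems(1), of r] by simp
  also have "rat_of_nat (card L choose r) = fact (card L) / (fact r * fact (size_of Q))"
    using binomial_fact[of r "card L", where 'a = rat] cL by simp
  finally show ?case unfolding Q by simp
qed

lemma runs_exist: "\<exists>rs. Q @ [East] = concat (map (\<lambda>r. replicate r North @ [East]) rs)"
proof (induction Q rule: weight.induct)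
  case 1
  show ?case by (intro exI[of _ "[0]"]) simp
next
  case (2 Q)
  then obtain rs where "Q @ [East] = concat (map (\<lambda>r. replicate r North @ [East]) rs)" by blast
  then show ?case by (intro exI[of _ "0 # rs"]) simp
next
  case (3 Q)
  then obtain rs where rs: "Q @ [East] = concat (map (\<lambda>r. replicate r North @ [East]) rs)" by blast
  then obtain r rs' where "rs = r # rs'" by (cases rs) auto
  with rs show ?case by (intro exI[of _ "Suc r # rs'"]) simp
qed

theorem card_labellings:
  assumes "size_of Q = n"
  shows "of_nat (card (labellings n Q)) = fact n * weight Q"
proof -
  obtain rs where rs: "Q @ [East] = concat (map (\<lambda>r. replicate r North @ [East]) rs)"
    using runs_exist[of Q] by (elim exE)
  have "north_positions (Q @ [East]) = north_positions Q"
    by (auto simp: north_positions_def nth_append less_Suc_eq split: if_splits)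
  then have "labellings n Q = labellings_by {1..n} (Q @ [East])"
    by (simp add: labellings_def labellings_by_def)
  then show ?thesis
    using card_labellings_by_runs[of "{1..n}" rs] assms by (simp flip: rs)
qed

section \<open>Contacts and the recursion for the generating functions\<close>

text \<open>The times at which an excursion from height \<open>k\<close> is at height \<open>0\<close>, in the form in which a path can be
split there.\<close>

definition returns :: "nat \<Rightarrow> nat \<Rightarrow> step list \<Rightarrow> nat set" where
  "returns m k P = {i. i \<le> length P \<and> excursion m k (take i P)}"

lemma finite_returns [simp]: "finite (returns m k P)"
  by (simp add: returns_def)

lemma contacts_eq_card_returns:
  assumes "excursion m 0 P"
  shows "contacts m P = card (returns m 0 P)"
proof -
  have "excursion m 0 (take i P) \<longleftrightarrow> count_list (take i P) East = m * size_of (take i P)"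
    if "i \<le> length P" for i
    using assms that by (auto simp: excursion_iff take_take min_def)
  then show ?thesis
    unfolding contacts_def returns_def by (metis (no_types, lifting))
qed

lemma card_returns_north: "card (returns m 0 (North # P)) = Suc (card (returns m m P))"
proof -
  have "returns m 0 (North # P) = insert 0 (Suc ` returns m m P)"
  proof (rule set_eqI)
    fix i show "i \<in> returns m 0 (North # P) \<longleftrightarrow> i \<in> insert 0 (Suc ` returns m m P)"
      by (cases i) (auto simp: returns_def)
  qed
  then show ?thesis by (simp add: card_image)
qed

text \<open>The two factors share the contact at which they are glued.\<close>

lemma card_returns_append:
  assumes "excursion m 0 A"
  shows "Suc (card (returns m 0 (A @ R))) = card (returns m 0 A) + card (returns m 0 R)"
proof -
  have "returns m 0 (A @ R) = returns m 0 A \<union> (\<lambda>i. i + length A) ` returns m 0 R"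
  proof (rule set_eqI)
    fix i
    show "i \<in> returns m 0 (A @ R) \<longleftrightarrow> i \<in> returns m 0 A \<union> (\<lambda>i. i + length A) ` returns m 0 R"
    proof (cases "i \<le> length A")
      case True
      have "i \<in> returns m 0 A" if "i \<in> (\<lambda>i. i + length A) ` returns m 0 R"
      proof -
        from that True have "i = length A" by auto
        then show ?thesis using assms by (simp add: returns_def)
      qed
      with True show ?thesis by (auto simp: returns_def)
    next
      case False
      then obtain j where "i = j + length A" by (metis add.commute le_add_diff_inverse nat_le_linear)
      with False show ?thesis
        using assms by (auto simp: returns_def excursion_append_0 image_iff)
    qed
  qed
  moreover have "returns m 0 A \<inter> (\<lambda>i. i + length A) ` returns m 0 R = {length A}"
    using assms by (auto simp: returns_def image_iff intro!: bexI[of _ 0])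
  moreover have "card ((\<lambda>i. i + length A) ` returns m 0 R) = card (returns m 0 R)"
    by (simp add: card_image)
  ultimately show ?thesis
    using card_Un_Int[of "returns m 0 A" "(\<lambda>i. i + length A) ` returns m 0 R"] by simp
qed

lemma card_returns_east:
  assumes "excursion m k P"
  shows "card (returns m (Suc k) (P @ East # A)) = card (returns m 0 A)"
proof -
  have "returns m (Suc k) (P @ East # A) = (\<lambda>i. i + Suc (length P)) ` returns m 0 A"
  proof (rule set_eqI)
    fix i
    show "i \<in> returns m (Suc k) (P @ East # A) \<longleftrightarrow> i \<in> (\<lambda>i. i + Suc (length P)) ` returns m 0 A"
    proof (cases "i \<le> length P")
      case True
      have "\<not> excursion m (Suc k) (take i P)"
        using excursion_prefix_le[of m "Suc k" "take i P" k "drop i P"] assms by auto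
      with True show ?thesis by (auto simp: returns_def)
    next
      case False
      then obtain j where "i = j + Suc (length P)"
        by (metis add.commute le_add_diff_inverse not_less_eq_eq)
      then show ?thesis
        using assms by (auto simp: returns_def excursion_append_E image_iff)
    qed
  qed
  then show ?thesis by (simp add: card_image inj_on_def)
qed

text \<open>The contacts of the tail that starts at a visit \<open>i\<close> are the visits from \<open>i\<close> on.\<close>

lemma card_returns_drop:
  assumes "i \<in> returns m k P"
  shows "card (returns m 0 (drop i P)) = card {j \<in> returns m k P. j \<ge> i}"
proof -
  have i: "i \<le> length P" "excursion m k (take i P)" using assms by (auto simp: returns_def)
  have "{j \<in> returns m k P. j \<ge> i} = (\<lambda>j. j + i) ` returns m 0 (drop i P)"
  proof (rule set_eqI)
    fix j
    show "j \<in> {j \<in> returns m k P. j \<ge> i} \<longleftrightarrow> j \<in> (\<lambda>j. j + i) ` returns m 0 (drop i P)"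
    proof (cases "j \<ge> i")
      case True
      then obtain l where l: "j = l + i" by (metis add.commute le_add_diff_inverse)
      have "take j P = take i P @ take l (drop i P)"
        by (simp add: l take_add add.commute)
      with i l show ?thesis
        by (auto simp: returns_def excursion_append_same image_iff)
    qed auto
  qed
  then show ?thesis by (simp add: card_image)
qed

definition interval_set :: "nat \<Rightarrow> nat \<Rightarrow> nat \<Rightarrow> nat \<Rightarrow> (step list \<times> step list) set" where
  "interval_set m k r n =
     {(P, Q). interval_rel m k P Q \<and> size_of Q = n \<and> initial_rise Q = r}"

lemma finite_excursions: "finite {P. excursion m k P \<and> size_of P = n}"
proof (rule finite_subset)
  have "length P = size_of P + count_list P East" for P
    by (induction P rule: weight.induct) auto
  then show "{P. excursion m k P \<and> size_of P = n} \<subseteq>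
      {P. set P \<subseteq> {North, East} \<and> length P = n + (k + m * n)}"
    using excursion_counts[of m k] step.exhaust by auto
  show "finite {P. set P \<subseteq> {North, East} \<and> length P = n + (k + m * n)}"
    by (rule finite_lists_length_eq) simp
qed

lemma finite_interval_rel: "finite {(P, Q). interval_rel m k P Q \<and> size_of Q = n}"
  by (rule finite_subset[OF _ finite_cartesian_product[OF finite_excursions[of m k n] finite_excursions[of m k n]]])
    (auto dest: interval_rel_excursion)

lemma finite_interval_set: "finite (interval_set m k r n)"
  by (rule finite_subset[OF _ finite_interval_rel[of m k n]]) (auto simp: interval_set_def)

text \<open>At level \<open>0\<close> this is \<open>F\<^sub>r\<close>; level \<open>k\<close> is the stage \<open>(F \<Delta>)\<^sup>k F\<^sub>r\<close> of the recursion.\<close>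

definition interval_gf :: "nat \<Rightarrow> nat \<Rightarrow> nat \<Rightarrow> rat poly fps" where
  "interval_gf m k r = Abs_fps (\<lambda>n. \<Sum>(P, Q)\<in>interval_set m k r n.
     monom (weight Q) (card (returns m k P)))"

lemma of_nat_times_monom: "of_nat c * monom a k = monom (of_nat c * (a :: rat)) k"
  by (simp add: of_nat_poly smult_monom)

lemma tamari_gf_y1_nth:
  "tamari_gf_y1 m $ n = (\<Sum>(P, Q) | interval_rel m 0 P Q \<and> size_of Q = n.
     monom (weight Q) (card (returns m 0 P)))"
proof -
  define I where "I = {(P, Q). interval_rel m 0 P Q \<and> size_of Q = n}"
  have finI: "finite I" unfolding I_def by (rule finite_interval_rel)
  have eq: "labelled_intervals m n = (\<lambda>(PQ, l). (fst PQ, snd PQ, l)) `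
      (SIGMA PQ : I. labellings n (snd PQ))"
    by (force simp: labelled_intervals_def tamari_intervals_iff I_def)
  have inj: "inj_on (\<lambda>(PQ, l). (fst PQ, snd PQ, l)) (SIGMA PQ : I. labellings n (snd PQ))"
    by (auto simp: inj_on_def)
  have fin: "finite (labellings n Q)" for Q
    unfolding labellings_def by (intro finite_Collect_conjI disjI1) (simp add: finite_PiE)
  have "tamari_gf_y1 m $ n = (\<Sum>(P, Q, l)\<in>labelled_intervals m n. monom (1 / fact n) (contacts m P))"
    by (simp add: tamari_gf_y1_def tamari_gf_def poly_sum poly_monom case_prod_unfold)
  also have "\<dots> = (\<Sum>(PQ, l) \<in> (SIGMA PQ : I. labellings n (snd PQ)).
      monom (1 / fact n) (contacts m (fst PQ)))"
    unfolding eq by (subst sum.reindex[OF inj]) (simp add: case_prod_unfold)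
  also have "\<dots> = (\<Sum>PQ\<in>I. \<Sum>l\<in>labellings n (snd PQ). monom (1 / fact n) (contacts m (fst PQ)))"
    using finI fin by (subst sum.Sigma) auto
  also have "\<dots> = (\<Sum>PQ\<in>I. monom (weight (snd PQ)) (card (returns m 0 (fst PQ))))"
  proof (intro sum.cong[OF refl])
    fix PQ assume "PQ \<in> I"
    then have *: "interval_rel m 0 (fst PQ) (snd PQ)" "size_of (snd PQ) = n" by (auto simp: I_def)
    show "(\<Sum>l\<in>labellings n (snd PQ). monom (1 / fact n) (contacts m (fst PQ))) =
        monom (weight (snd PQ)) (card (returns m 0 (fst PQ)))"
      using card_labellings[OF *(2)] contacts_eq_card_returns[of m "fst PQ"]
        interval_rel_excursion[OF *(1)]
      by (simp add: of_nat_times_monom)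
  qed
  finally show ?thesis by (simp add: I_def case_prod_unfold)
qed

lemma initial_rise_le: "initial_rise Q \<le> size_of Q"
  by (induction Q rule: weight.induct) auto

lemma tamari_gf_y1_by_rise:
  "tamari_gf_y1 m $ n = (\<Sum>r\<le>n. interval_gf m 0 r $ n)"
proof -
  have "{(P, Q). interval_rel m 0 P Q \<and> size_of Q = n} = (\<Union>r\<le>n. interval_set m 0 r n)"
    using initial_rise_le by (auto simp: interval_set_def)
  moreover have "interval_set m 0 r n \<inter> interval_set m 0 r' n = {}" if "r \<noteq> r'" for r r'
    using that by (auto simp: interval_set_def)
  ultimately show ?thesis
    unfolding tamari_gf_y1_nth interval_gf_def
    by (simp add: sum.UNION_disjoint finite_interval_set)
qed

text \<open>Every north step of the initial rise contributes to the size, so sums over the initial rise are locally finite.\<close>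

lemma interval_gf_order:
  assumes "n < r"
  shows "interval_gf m k r $ n = 0"
proof -
  have "interval_set m k r n = {}"
  proof -
    have "\<not> (size_of Q = n \<and> initial_rise Q = r)" for Q
      using assms initial_rise_le[of Q] by auto
    then show ?thesis by (auto simp: interval_set_def)
  qed
  then show ?thesis by (simp add: interval_gf_def)
qed

lemma interval_gf_0: "interval_gf m 0 0 = fps_const (monom 1 1)"
proof (rule fps_ext)
  fix n
  have "Q = [] \<and> P = []" if "interval_rel m 0 P Q" "initial_rise Q = 0" for P Q
    using that by cases auto
  then have nil: "interval_rel m 0 P Q \<and> initial_rise Q = 0 \<longleftrightarrow> P = [] \<and> Q = []" for P Q
    by (metis interval_rel.empty initial_rise_simps(1))
  have "interval_set m 0 0 n =
      {(P, Q). (interval_rel m 0 P Q \<and> initial_rise Q = 0) \<and> size_of Q = n}"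
    by (auto simp: interval_set_def)
  also have "\<dots> = (if n = 0 then {([], [])} else {})"
    unfolding nil by auto
  finally have "interval_set m 0 0 n = (if n = 0 then {([], [])} else {})" .
  moreover have "returns m 0 [] = {0}" by (auto simp: returns_def)
  ultimately show "interval_gf m 0 0 $ n = fps_const (monom 1 1) $ n"
    by (simp add: interval_gf_def)
qed

lemma interval_gf_north:
  "interval_gf m 0 (Suc r) =
     fps_X * fps_const (monom (1 / of_nat (Suc r)) 1) * interval_gf m m r"
proof (rule fps_ext)
  fix n
  show "interval_gf m 0 (Suc r) $ n =
    (fps_X * fps_const (monom (1 / of_nat (Suc r)) 1) * interval_gf m m r) $ n"
  proof (cases n)
    case 0
    then show ?thesis by (simp add: mult.assoc interval_gf_order)
  next
    case (Suc n')
    have cases: "\<exists>P' Q'. P = North # P' \<and> Q = North # Q' \<and> interval_rel m m P' Q'"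
      if "interval_rel m 0 P Q" "initial_rise Q > 0" for P Q
      using that by cases auto
    define h :: "step list \<times> step list \<Rightarrow> step list \<times> step list"
      where "h = (\<lambda>PQ. (North # fst PQ, North # snd PQ))"
    have "inj_on h (interval_set m m r n')" by (auto simp: h_def inj_on_def prod_eq_iff)
    moreover have "interval_set m 0 (Suc r) n = h ` interval_set m m r n'"
    proof (intro equalityI subsetI)
      fix v assume "v \<in> interval_set m 0 (Suc r) n"
      then obtain P Q where "v = (P, Q)" "interval_rel m 0 P Q" "size_of Q = n" "initial_rise Q = Suc r"
        by (auto simp: interval_set_def)
      with cases[of P Q] obtain P' Q' where "v = h (P', Q')" "(P', Q') \<in> interval_set m m r n'"
        by (auto simp: interval_set_def h_def Suc)
      then show "v \<in> h ` interval_set m m r n'" by blast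
    qed (auto simp: interval_set_def h_def Suc intro: interval_rel.north)
    ultimately have "interval_gf m 0 (Suc r) $ n = (\<Sum>(P, Q)\<in>interval_set m m r n'.
        monom (weight (North # Q)) (card (returns m 0 (North # P))))"
      by (simp add: interval_gf_def sum.reindex h_def case_prod_unfold)
    also have "\<dots> = (\<Sum>(P, Q)\<in>interval_set m m r n'. monom (1 / of_nat (Suc r)) 1 *
       monom (weight Q) (card (returns m m P)))"
      by (intro sum.cong) (auto simp: interval_set_def card_returns_north mult_monom)
    finally show ?thesis
      by (simp add: Suc mult.assoc interval_gf_def sum_distrib_left case_prod_unfold)
  qed
qed

text \<open>The operator \<open>p \<mapsto> (p(x) - p(1)) / (x - 1)\<close> on the coefficients.\<close>

definition divided_difference :: "rat poly fps \<Rightarrow> rat poly fps" where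
  "divided_difference f = Abs_fps (\<lambda>n. synthetic_div (f $ n) 1)"

lemma synthetic_div_add: "synthetic_div (p + q) c = synthetic_div p c + synthetic_div q (c :: 'a :: comm_ring_1)"
proof -
  have "(p + q) + smult c (synthetic_div p c + synthetic_div q c) =
      (p + smult c (synthetic_div p c)) + (q + smult c (synthetic_div q c))"
    by (simp add: smult_add_right)
  also have "\<dots> = pCons (poly p c + poly q c) (synthetic_div p c + synthetic_div q c)"
    by (simp add: synthetic_div_correct)
  finally show ?thesis by (rule synthetic_div_unique[THEN conjunct2, symmetric])
qed

lemma synthetic_div_sum: "synthetic_div (\<Sum>x\<in>A. f x) c = (\<Sum>x\<in>A. synthetic_div (f x) (c :: 'a :: comm_ring_1))"
  by (induction A rule: infinite_finite_induct) (simp_all add: synthetic_div_add)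

text \<open>\<open>(x\<^sup>n - 1) / (x - 1) = 1 + x + \<dots> + x\<^sup>n\<^sup>-\<^sup>1\<close>.\<close>

lemma synthetic_div_monom:
  "synthetic_div (monom a n) 1 = (\<Sum>i<n. monom (a :: 'a :: comm_ring_1) i)"
proof (induction n)
  case (Suc n)
  have "synthetic_div (monom a (Suc n)) 1 = pCons a (\<Sum>i<n. monom a i)"
    by (simp add: monom_Suc Suc poly_monom)
  also have "\<dots> = [:a:] + monom 1 1 * (\<Sum>i<n. monom a i)"
    by (simp add: monom_Suc)
  also have "\<dots> = (\<Sum>i<Suc n. monom a i)"
    by (simp add: sum.lessThan_Suc_shift sum_distrib_left mult_monom monom_0 del: sum.lessThan_Suc)
  finally show ?case .
qed (simp add: monom_0)

text \<open>Counting the elements above gives each rank once. For the visits of a lower path to height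
\<open>0\<close>, this turns the choice of a visit into a divided difference.\<close>

lemma sum_rank:
  fixes Z :: "nat set"
  assumes "finite Z"
  shows "(\<Sum>i\<in>Z. f (card {j \<in> Z. j \<ge> i} - 1)) = (\<Sum>i<card Z. f i)"
  using assms
proof (induction Z rule: finite_linorder_min_induct)
  case (insert b Z)
  have b: "b \<notin> Z" using insert by auto
  have "{j \<in> insert b Z. j \<ge> b} = insert b Z" using insert by auto
  moreover have "{j \<in> insert b Z. j \<ge> i} = {j \<in> Z. j \<ge> i}" if "i \<in> Z" for i
    using insert that by auto
  ultimately show ?case using insert b by (simp add: add.commute)
qed simp

lemma sum_Sigma_nested:
  assumes "finite A" "\<And>j. finite (B j)" "\<And>j. finite (C j)" "\<And>x. finite (D x)"
  shows "(\<Sum>u\<in>(SIGMA j : A. B j \<times> (SIGMA x : C j. D x)). f u) =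
    (\<Sum>j\<in>A. \<Sum>y\<in>B j. \<Sum>x\<in>C j. \<Sum>i\<in>D x. f (j, y, x, i))"
  using assms by (simp add: sum.Sigma sum.cartesian_product split_def)

text \<open>By the last rule of \<open>interval_rel\<close>, a pair at level \<open>k + 1\<close> consists of a pair at level \<open>k\<close>, a visit to height \<open>0\<close> of
its lower path, and an interval. The visits of the new lower path are those of the tail from the chosen
visit on and those of the lower path of the interval, with one visit in common. Hence the
factor \<open>x\<^sup>j\<^sup>-\<^sup>1\<close> for the tail, where \<open>j\<close> is its number of visits.\<close>

lemma interval_gf_east:
  "interval_gf m (Suc k) r = tamari_gf_y1 m * divided_difference (interval_gf m k r)"
proof (rule fps_ext)
  fix n
  define All where "All j = {(R, S). interval_rel m 0 R S \<and> size_of S = j}" for j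
  \<comment> \<open>\<open>U\<close> collects the choices of an interval of size \<open>j\<close>, a pair at level \<open>k\<close> and a visit \<open>i\<close>; \<open>g\<close> assembles the new pair.\<close>
  define U where "U = (SIGMA j : {..n}. All j \<times>
     (SIGMA XQ : interval_set m k r (n - j). returns m k (fst XQ)))"
  define g where "g = (\<lambda>(j :: nat, RS, XQ, i).
     (take i (fst XQ) @ East # drop i (fst XQ) @ fst RS, snd XQ @ East # snd RS :: step list))"
  have finAll: "finite (All j)" for j unfolding All_def by (rule finite_interval_rel)
  have inj: "inj_on g U"
  proof (rule inj_onI)
    fix u u' assume u: "u \<in> U" "u' \<in> U" and eq: "g u = g u'"
    obtain j R S X Q i where u_eq: "u = (j, (R, S), (X, Q), i)" by (metis surj_pair)
    obtain j' R' S' X' Q' i' where u'_eq: "u' = (j', (R', S'), (X', Q'), i')" by (metis surj_pair)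
    have 1: "interval_rel m 0 R S" "size_of S = j" "interval_rel m k X Q" "i \<le> length X"
       "excursion m k (take i X)" "interval_rel m 0 R' S'" "size_of S' = j'" "interval_rel m k X' Q'"
       "i' \<le> length X'" "excursion m k (take i' X')"
      using u unfolding U_def u_eq u'_eq by (auto simp: All_def interval_set_def returns_def)
    have e1: "take i X @ East # drop i X @ R = take i' X' @ East # drop i' X' @ R'"
      and e2: "Q @ East # S = Q' @ East # S'" using eq by (simp_all add: g_def u_eq u'_eq)
    have Q: "Q = Q'" "S = S'"
      using excursion_split_E_unique[OF e2] 1 interval_rel_excursion by blast+
    have X: "take i X = take i' X'" "drop i X @ R = drop i' X' @ R'"
      using excursion_split_E_unique[OF e1] 1 by blast+
    \<comment> \<open>The border between the tail of \<open>X\<close> and \<open>R\<close> is recovered from the size of \<open>R\<close>, which is that of \<open>S\<close>.\<close>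
    have "length R = length R'"
    proof -
      have len: "length P = size_of P + count_list P East" for P
        by (induction P rule: weight.induct) auto
      have "excursion m 0 R" "excursion m 0 R'" "size_of R = size_of R'"
        using 1 Q interval_rel_excursion by metis+
      then show ?thesis using excursion_counts[of m 0 R] excursion_counts[of m 0 R'] len
        by metis
    qed
    with X have "R = R'" "drop i X = drop i' X'" by simp_all
    moreover from this X have "X = X'" by (metis append_take_drop_id)
    moreover have "i = i'" using arg_cong[OF X(1), of length] 1 by simp
    ultimately show "u = u'" using Q 1 by (simp add: u_eq u'_eq)
  qed
  have img: "g ` U = interval_set m (Suc k) r n"
  proof (intro equalityI subsetI)
    fix v assume "v \<in> g ` U"
    then obtain u where u: "v = g u" "u \<in> U" by blast
    obtain j R S X Q i where u_eq: "u = (j, (R, S), (X, Q), i)" by (metis surj_pair)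
    from u have v: "v = g (j, (R, S), (X, Q), i)" "(j, (R, S), (X, Q), i) \<in> U"
      unfolding u_eq by blast+
    then have 1: "interval_rel m 0 R S" "interval_rel m k (take i X @ drop i X) Q"
       "excursion m k (take i X)" "i \<le> length X" "size_of S + size_of Q = n" "initial_rise Q = r"
      unfolding U_def by (auto simp: All_def interval_set_def returns_def)
    have "excursion m 0 (drop i X)"
      using 1(2,3) interval_rel_excursion excursion_append_same by blast
    from interval_rel.east[OF 1(2,3) this 1(1)] 1 show "v \<in> interval_set m (Suc k) r n"
      by (simp add: v g_def interval_set_def)
  next
    fix v assume "v \<in> interval_set m (Suc k) r n"
    then obtain P Q where v: "v = (P, Q)" "interval_rel m (Suc k) P Q" "size_of Q = n"
      "initial_rise Q = r" by (auto simp: interval_set_def)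
    from v(2) show "v \<in> g ` U"
    proof cases
      case (east P0 A Q0 R S)
      have "length P0 \<in> returns m k (P0 @ A)" using east by (simp add: returns_def)
      then have "(size_of S, (R, S), (P0 @ A, Q0), length P0) \<in> U"
        unfolding U_def using east v by (simp add: All_def interval_set_def)
      moreover have "v = g (size_of S, (R, S), (P0 @ A, Q0), length P0)"
        by (simp add: v east g_def)
      ultimately show ?thesis by blast
    qed
  qed
  have summand: "monom (weight (snd (g u))) (card (returns m (Suc k) (fst (g u)))) =
     monom (weight S) (card (returns m 0 R)) *
     monom (weight Q) (card {j \<in> returns m k X. j \<ge> i} - 1)"
    if "u \<in> U" "u = (j, (R, S), (X, Q), i)" for u j R S X Q i
  proof -
    have 1: "interval_rel m 0 R S" "interval_rel m k (take i X @ drop i X) Q" "i \<in> returns m k X"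
       "excursion m k (take i X)"
      using that unfolding U_def by (auto simp: All_def interval_set_def returns_def)
    have ex: "excursion m 0 (drop i X)"
      using 1(2,4) interval_rel_excursion excursion_append_same by blast
    have "{j \<in> returns m k X. j \<ge> i} \<noteq> {}" using 1 by auto
    then have "card {j \<in> returns m k X. j \<ge> i} > 0" by (simp add: card_gt_0_iff)
    with card_returns_append[OF ex, of R] have
      "card (returns m 0 (drop i X @ R)) = card (returns m 0 R) + (card {j \<in> returns m k X. j \<ge> i} - 1)"
      unfolding card_returns_drop[OF 1(3)] by linarith
    with card_returns_east[OF 1(4), of "drop i X @ R"] show ?thesis
      by (simp add: that(2) g_def mult_monom mult.commute)
  qed
  have rank: "(\<Sum>i\<in>returns m k X. monom w (card {j \<in> returns m k X. j \<ge> i} - 1)) =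
      synthetic_div (monom w (card (returns m k X))) 1" for X and w :: rat
    by (simp only: sum_rank[OF finite_returns] synthetic_div_monom)
  have gf_nth: "tamari_gf_y1 m $ j = (\<Sum>(R, S)\<in>All j. monom (weight S) (card (returns m 0 R)))" for j
    by (simp only: tamari_gf_y1_nth All_def)
  have dd_nth: "divided_difference (interval_gf m k r) $ l =
      (\<Sum>(X, Q)\<in>interval_set m k r l. synthetic_div (monom (weight Q) (card (returns m k X))) 1)" for l
    by (simp only: divided_difference_def interval_gf_def fps_nth_Abs_fps synthetic_div_sum case_prod_unfold)
  have "interval_gf m (Suc k) r $ n = (\<Sum>u\<in>U. monom (weight (snd (g u))) (card (returns m (Suc k) (fst (g u)))))"
    unfolding interval_gf_def using inj
    by (simp add: img[symmetric] sum.reindex case_prod_unfold)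
  also have "\<dots> = (\<Sum>(j, (R, S), (X, Q), i)\<in>U. monom (weight S) (card (returns m 0 R)) *
     monom (weight Q) (card {j \<in> returns m k X. j \<ge> i} - 1))"
    by (intro sum.cong refl) (auto simp del: mult_monom simp: summand)
  also have "\<dots> = (\<Sum>j\<le>n. \<Sum>(R, S)\<in>All j. \<Sum>(X, Q)\<in>interval_set m k r (n - j). \<Sum>i\<in>returns m k X.
     monom (weight S) (card (returns m 0 R)) *
     monom (weight Q) (card {j \<in> returns m k X. j \<ge> i} - 1))"
    unfolding U_def
    by (subst sum_Sigma_nested) (simp_all add: finAll finite_interval_set case_prod_unfold)
  also have "\<dots> = (\<Sum>j\<le>n. (\<Sum>(R, S)\<in>All j. monom (weight S) (card (returns m 0 R))) *
      (\<Sum>(X, Q)\<in>interval_set m k r (n - j). synthetic_div (monom (weight Q) (card (returns m k X))) 1))"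
    unfolding case_prod_unfold sum_product unfolding rank[symmetric] sum_distrib_left by (rule refl)
  also have "\<dots> = (tamari_gf_y1 m * divided_difference (interval_gf m k r)) $ n"
    by (simp only: fps_mult_nth atLeast0AtMost gf_nth dd_nth)
  finally show "interval_gf m (Suc k) r $ n =
    (tamari_gf_y1 m * divided_difference (interval_gf m k r)) $ n" .
qed

section \<open>Lagrange interpolation\<close>

lemma degree_prod_linear: "degree (\<Prod>l\<in>I. [:- v l, 1 :: 'a :: idom:]) = card I"
  by (subst degree_prod_sum_eq) auto

lemma coeff_prod_linear: "coeff (\<Prod>l\<in>I. [:- v l, 1 :: 'a :: idom:]) (card I) = 1"
  using lead_coeff_prod[of "\<lambda>l. [:- v l, 1:]" I] by (simp add: degree_prod_linear)

text \<open>The weights \<open>K i\<close> are the reciprocals of the products in the Lagrange basis. They are given by an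
equation so that the lemmas hold in any integral domain; the points are then automatically distinct.\<close>

context
  fixes I :: "'i set" and v K :: "'i \<Rightarrow> 'a :: idom"
  assumes fin: "finite I"
    and K: "\<And>i. i \<in> I \<Longrightarrow> K i * (\<Prod>l\<in>I - {i}. v i - v l) = 1"
begin

lemma lagrange_interpolation:
  assumes "j < card I"
  shows "(\<Sum>i\<in>I. smult (K i * v i ^ j) (\<Prod>l\<in>I - {i}. [:- v l, 1:])) = monom 1 j"
    (is "?p = _")
proof -
  have inj: "inj_on v I"
  proof (rule inj_onI, rule ccontr)
    fix i l assume *: "i \<in> I" "l \<in> I" "v i = v l" "i \<noteq> l"
    then have "(\<Prod>l\<in>I - {i}. v i - v l) = 0"
      using fin by (intro prod_zero) (auto intro!: bexI[of _ l])
    with K[OF *(1)] show False by simp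
  qed
  have val: "poly ?p (v i) = v i ^ j" if i: "i \<in> I" for i
  proof -
    have "poly ?p (v i) = (\<Sum>k\<in>I. K k * v k ^ j * (\<Prod>l\<in>I - {k}. v i - v l))"
      by (simp add: poly_sum poly_prod)
    also have "\<dots> = (\<Sum>k\<in>I. if k = i then v i ^ j else 0)"
    proof (rule sum.cong[OF refl])
      fix k assume k: "k \<in> I"
      show "K k * v k ^ j * (\<Prod>l\<in>I - {k}. v i - v l) = (if k = i then v i ^ j else 0)"
      proof (cases "k = i")
        case True
        then show ?thesis using K[OF i] by (simp add: mult.commute mult.left_commute)
      next
        case False
        then have "(\<Prod>l\<in>I - {k}. v i - v l) = 0"
          using fin i by (intro prod_zero) (auto intro!: bexI[of _ i])
        with False show ?thesis by simp
      qed
    qed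
    finally show ?thesis using fin i by simp
  qed
  have deg: "degree (?p - monom 1 j) < card I"
  proof (rule le_less_trans[OF degree_diff_le[of _ "card I - 1"]])
    show "degree ?p \<le> card I - 1"
      by (intro degree_sum_le fin order.trans[OF degree_smult_le])
        (auto simp: degree_prod_linear fin)
    show "degree (monom (1 :: 'a) j) \<le> card I - 1"
      using assms by (simp add: degree_monom_eq)
  qed (use assms in auto)
  have roots: "v ` I \<subseteq> {x. poly (?p - monom 1 j) x = 0}"
    using val by (auto simp: poly_monom)
  have "?p - monom 1 j = 0"
  proof (rule ccontr)
    assume nz: "?p - monom 1 j \<noteq> 0"
    have "card I = card (v ` I)" by (simp add: card_image[OF inj])
    also have "\<dots> \<le> card {x. poly (?p - monom 1 j) x = 0}"
      by (rule card_mono[OF poly_roots_finite[OF nz] roots])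
    also have "\<dots> \<le> degree (?p - monom 1 j)" by (rule card_poly_roots_bound[OF nz])
    finally show False using deg by simp
  qed
  then show ?thesis by simp
qed

text \<open>Compare the leading coefficients in the interpolation of a power.\<close>

lemma lagrange_sum:
  assumes "j < card I"
  shows "(\<Sum>i\<in>I. K i * v i ^ j) = (if Suc j = card I then 1 else 0)"
proof -
  have "(\<Sum>i\<in>I. K i * v i ^ j) =
      coeff (\<Sum>i\<in>I. smult (K i * v i ^ j) (\<Prod>l\<in>I - {i}. [:- v l, 1:])) (card I - 1)"
  proof (unfold coeff_sum, rule sum.cong[OF refl])
    fix i assume "i \<in> I"
    with fin have "card I - 1 = card (I - {i})" by simp
    then show "K i * v i ^ j = coeff (smult (K i * v i ^ j) (\<Prod>l\<in>I - {i}. [:- v l, 1:])) (card I - 1)"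
      by (simp add: coeff_prod_linear)
  qed
  also have "\<dots> = (if Suc j = card I then 1 else 0)"
    unfolding lagrange_interpolation[OF assms] using assms by auto
  finally show ?thesis .
qed

text \<open>Evaluate at \<open>0\<close> the interpolation of the constant \<open>1\<close>.\<close>

lemma lagrange_sum_inverse:
  assumes "I \<noteq> {}" and N: "\<And>i. i \<in> I \<Longrightarrow> N i * v i = 1"
  shows "(\<Sum>i\<in>I. K i * N i) = (-1) ^ (card I - 1) * (\<Prod>i\<in>I. N i)"
proof -
  have c: "0 < card I" using assms fin by (simp add: card_gt_0_iff)
  have "poly (\<Sum>i\<in>I. smult (K i * v i ^ 0) (\<Prod>l\<in>I - {i}. [:- v l, 1:])) 0 = 1"
    using lagrange_interpolation[OF c] by (simp add: poly_monom)
  then have one: "(\<Sum>i\<in>I. K i * (\<Prod>l\<in>I - {i}. - v l)) = 1"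
    by (simp add: poly_sum poly_prod)
  have "(\<Prod>i\<in>I. - N i) = (\<Sum>i\<in>I. K i * (\<Prod>l\<in>I - {i}. - v l)) * (\<Prod>i\<in>I. - N i)"
    unfolding one by (rule mult_1_left[symmetric])
  also have "\<dots> = (\<Sum>i\<in>I. - (K i * N i))"
    unfolding sum_distrib_right
  proof (rule sum.cong[OF refl])
    fix i assume i: "i \<in> I"
    have "(\<Prod>l\<in>I - {i}. - v l) * (\<Prod>i\<in>I. - N i) = - N i * (\<Prod>l\<in>I - {i}. (- v l) * (- N l))"
      unfolding prod.distrib prod.remove[OF fin i, of "\<lambda>i. - N i"] by (simp only: ac_simps)
    also have "(\<Prod>l\<in>I - {i}. (- v l) * (- N l)) = 1"
      by (rule prod.neutral) (simp add: N mult.commute)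
    finally show "K i * (\<Prod>l\<in>I - {i}. - v l) * (\<Prod>i\<in>I. - N i) = - (K i * N i)"
      by (simp add: mult.assoc)
  qed
  finally have "(\<Sum>i\<in>I. K i * N i) = - (\<Prod>i\<in>I. - N i)" by (simp add: sum_negf)
  also have "(\<Prod>i\<in>I. - N i) = (-1) ^ card I * (\<Prod>i\<in>I. N i)"
    using prod.distrib[of "\<lambda>_. -1" N I] by simp
  finally show ?thesis using c by (cases "card I") simp_all
qed

end

section \<open>The roots of the kernel\<close>

lemma coeff_prod_linear_subleading:
  assumes "finite I" "I \<noteq> {}"
  shows "coeff (\<Prod>c\<in>I. [:- c, 1 :: 'a :: idom:]) (card I - 1) = - \<Sum>I"
  using assms
proof (induction rule: finite_ne_induct)
  case (insert c I)
  then obtain n where n: "card I = Suc n" by (cases "card I") auto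
  have "coeff (\<Prod>c\<in>insert c I. [:- c, 1 :: 'a:]) (card (insert c I) - 1) =
     coeff ([:- c, 1:] * (\<Prod>c\<in>I. [:- c, 1:])) (Suc n)"
    using insert n by simp
  also have "\<dots> = - c * coeff (\<Prod>c\<in>I. [:- c, 1:]) (card I) + coeff (\<Prod>c\<in>I. [:- c, 1:]) (card I - 1)"
    using n by simp
  also have "\<dots> = - c - \<Sum>I"
    using insert.IH coeff_prod_linear[of "\<lambda>c. c" I] by simp
  finally show ?case using insert by simp
qed simp

lemma coeff_one_plus_X_power: "coeff ([:1, 1 :: 'a :: comm_ring_1:] ^ n) k = of_nat (n choose k)"
proof (induction n arbitrary: k)
  case (Suc n)
  show ?case by (cases k) (simp_all add: Suc)
qed (auto simp: gr0_conv_Suc)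

text \<open>Its roots are the values of \<open>u\<close> with \<open>x v\<^sup>m = w\<close>, where \<open>v = ((1 + u) / u) e\<^sup>z\<^sup>u\<close>.\<close>

definition kernel_poly :: "nat \<Rightarrow> complex \<Rightarrow> complex poly" where
  "kernel_poly m w = [:1, 1:] ^ Suc m - monom w m"

definition kernel_roots :: "nat \<Rightarrow> complex \<Rightarrow> complex set" where
  "kernel_roots m w = {c. poly (kernel_poly m w) c = 0}"

text \<open>A double root of the kernel has to be \<open>u = m\<close>, which happens only for \<open>w = (m + 1)\<^sup>m\<^sup>+\<^sup>1 / m\<^sup>m\<close>.\<close>

definition generic :: "nat \<Rightarrow> complex \<Rightarrow> bool" where
  "generic m w \<longleftrightarrow> w \<noteq> 0 \<and> w * of_nat m ^ m \<noteq> of_nat (Suc m) ^ Suc m"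

lemma kernel_root_iff: "c \<in> kernel_roots m w \<longleftrightarrow> (1 + c) ^ Suc m = w * c ^ m"
  by (simp add: kernel_roots_def kernel_poly_def poly_monom poly_power del: power_Suc)

lemma kernel_root_nz:
  assumes "m \<ge> 1" "w \<noteq> 0" "c \<in> kernel_roots m w"
  shows "c \<noteq> 0" "1 + c \<noteq> 0"
  using assms by (auto simp: kernel_root_iff zero_power)

lemma kernel_poly_decompose:
  assumes m: "m \<ge> 1" and w: "generic m w"
  shows "finite (kernel_roots m w)" "card (kernel_roots m w) = Suc m"
    "kernel_poly m w = (\<Prod>c\<in>kernel_roots m w. [:- c, 1:])"
proof -
  have deg1: "degree ([:1, 1 :: complex:] ^ Suc m) = Suc m"
    by (simp add: degree_power_eq del: power_Suc)
  have "degree (monom w m) < degree ([:1, 1 :: complex:] ^ Suc m)"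
    using degree_monom_le[of w m] deg1 by linarith
  then have deg: "degree (kernel_poly m w) = Suc m"
    unfolding kernel_poly_def diff_conv_add_uminus using deg1 by (subst degree_add_eq_left) auto
  have lc: "lead_coeff (kernel_poly m w) = 1"
    unfolding deg by (simp add: kernel_poly_def coeff_one_plus_X_power del: power_Suc)
  have "rsquarefree (kernel_poly m w)"
    unfolding rsquarefree_roots
  proof (intro allI notI)
    fix c assume "poly (kernel_poly m w) c = 0 \<and> poly (pderiv (kernel_poly m w)) c = 0"
    then have r: "c \<in> kernel_roots m w" and d: "poly (pderiv (kernel_poly m w)) c = 0"
      by (auto simp: kernel_roots_def)
    have nz: "c \<noteq> 0" "1 + c \<noteq> 0" using kernel_root_nz[OF m _ r] w by (auto simp: generic_def)
    have e: "(1 + c) ^ Suc m = w * c ^ m" using r by (simp add: kernel_root_iff)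
    have "of_nat (Suc m) * (1 + c) ^ m = w * of_nat m * c ^ (m - 1)"
      using d by (simp add: kernel_poly_def pderiv_diff pderiv_power_Suc pderiv_pCons pderiv_monom poly_monom
          poly_power algebra_simps del: power_Suc)
    then have "of_nat (Suc m) * (1 + c) ^ Suc m * c = w * of_nat m * (c ^ (m - 1) * c) * (1 + c)"
      by (simp add: algebra_simps)
    also have "c ^ (m - 1) * c = c ^ m" using m by (simp flip: power_Suc2)
    finally have "w * c ^ m * (of_nat (Suc m) * c - of_nat m * (1 + c)) = 0"
      unfolding e by (simp add: algebra_simps)
    then have "c = of_nat m" using nz w by (simp add: generic_def algebra_simps)
    with e w show False by (simp add: generic_def add.commute)
  qed
  from complex_poly_decompose_rsquarefree[OF this]
  show dec: "kernel_poly m w = (\<Prod>c\<in>kernel_roots m w. [:- c, 1:])"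
    by (simp add: lc kernel_roots_def)
  have "kernel_poly m w \<noteq> 0" using lc by force
  then show "finite (kernel_roots m w)" by (simp add: kernel_roots_def poly_roots_finite)
  show "card (kernel_roots m w) = Suc m"
    using deg degree_prod_linear[of "\<lambda>c. c" "kernel_roots m w"] by (simp add: dec)
qed

lemma kernel_vieta:
  assumes m: "m \<ge> 1" and w: "generic m w"
  shows "(\<Prod>c\<in>kernel_roots m w. c) = (-1) ^ Suc m"
    "(\<Prod>c\<in>kernel_roots m w. 1 + c) = w"
    "\<Sum>(kernel_roots m w) = w - of_nat (Suc m)"
proof -
  note dec = kernel_poly_decompose[OF m w]
  have "poly (kernel_poly m w) 0 = 1" using m by (simp add: kernel_poly_def poly_monom poly_power zero_power)
  then have "(\<Prod>c\<in>kernel_roots m w. - c) = 1" by (simp add: dec(3) poly_prod)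
  also have "(\<Prod>c\<in>kernel_roots m w. - c) = (-1) ^ Suc m * (\<Prod>c\<in>kernel_roots m w. c)"
    using prod.distrib[of "\<lambda>_. -1" "\<lambda>c. c" "kernel_roots m w"] dec(2) by simp
  finally have "(-1) ^ Suc m * ((-1) ^ Suc m * (\<Prod>c\<in>kernel_roots m w. c)) = (-1) ^ Suc m" by simp
  then show "(\<Prod>c\<in>kernel_roots m w. c) = (-1) ^ Suc m"
    unfolding mult.assoc[symmetric] power_mult_distrib[symmetric] by simp
  have "poly (kernel_poly m w) (-1) = (-1) ^ Suc m * w"
    by (simp add: kernel_poly_def poly_monom poly_power)
  also have "poly (kernel_poly m w) (-1) = (\<Prod>c\<in>kernel_roots m w. -1 * (1 + c))"
    unfolding dec(3) by (simp add: poly_prod algebra_simps)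
  also have "\<dots> = (-1) ^ Suc m * (\<Prod>c\<in>kernel_roots m w. 1 + c)"
    unfolding prod.distrib using dec(2) by simp
  finally show "(\<Prod>c\<in>kernel_roots m w. 1 + c) = w" by simp
  have "coeff (kernel_poly m w) m = of_nat (Suc m) - w"
    by (simp add: kernel_poly_def coeff_one_plus_X_power del: power_Suc)
  also have "coeff (kernel_poly m w) m = - \<Sum>(kernel_roots m w)"
    using coeff_prod_linear_subleading[of "kernel_roots m w"] dec by fastforce
  finally show "\<Sum>(kernel_roots m w) = w - of_nat (Suc m)" by (simp add: algebra_simps)
qed

section \<open>Power sums over the roots\<close>

text \<open>The sums \<open>\<Sum> K u\<^sup>j\<^sup>-\<^sup>m\<close> over the roots, with the Lagrange weights of the points \<open>(1 + u) / u = 1 + 1 / u\<close>, as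
polynomials in \<open>w\<close>: for \<open>j \<le> m\<close> they are Lagrange sums of powers of \<open>1 / u\<close>, and beyond that the kernel
equation, expanded by the binomial theorem, is a linear recurrence.\<close>

fun kernel_moment :: "nat \<Rightarrow> nat \<Rightarrow> complex poly" where
  "kernel_moment m j = (if j = 0 then 1 else if j \<le> m then 0 else
     [:0, 1:] * kernel_moment m (j - 1) -
     (\<Sum>i\<le>m. smult (of_nat (Suc m choose i)) (kernel_moment m (j - Suc m + i))))"

declare kernel_moment.simps [simp del]

lemma kernel_moment_small: "0 < j \<Longrightarrow> j \<le> m \<Longrightarrow> kernel_moment m j = 0"
  by (subst kernel_moment.simps) simp

lemma kernel_moment_rec:
  "kernel_moment m (Suc m + p) = [:0, 1:] * kernel_moment m (m + p) -
     (\<Sum>i\<le>m. smult (of_nat (Suc m choose i)) (kernel_moment m (p + i)))"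
  by (subst kernel_moment.simps) simp

text \<open>Each step of the recurrence beyond \<open>j = m + 1\<close> raises the degree by one through the factor \<open>w\<close>; all other
terms have smaller degree.\<close>

lemma coeff_kernel_moment:
  assumes m: "m \<ge> 1"
  shows "q \<ge> p \<Longrightarrow> coeff (kernel_moment m (Suc m + p)) q = (if q = p then -1 else 0)"
proof (induction p arbitrary: q rule: less_induct)
  case (less p)
  show ?case
  proof (cases p)
    case 0
    have "(\<Sum>i\<le>m. smult (of_nat (Suc m choose i)) (kernel_moment m (0 + i))) =
        (\<Sum>i\<le>m. if i = 0 then 1 else 0)"
      by (intro sum.cong refl) (auto simp: kernel_moment_small, simp add: kernel_moment.simps)
    also have "\<dots> = 1" by simp
    finally have "kernel_moment m (Suc m + p) = -1"
      using m unfolding 0 kernel_moment_rec by (simp add: kernel_moment_small)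
    then show ?thesis using 0 by (simp split: nat.split)
  next
    case (Suc p')
    have small: "coeff (kernel_moment m (p + i)) q = 0" if "i \<le> m" for i
    proof (cases "p + i \<le> m")
      case True
      then show ?thesis using Suc by (simp add: kernel_moment_small)
    next
      case False
      then obtain l where l: "p + i = Suc m + l" by (metis add_Suc le_add_diff_inverse not_less_eq_eq)
      with that have "l < p" by simp
      with less.IH[of l q] less.prems show ?thesis unfolding l by simp
    qed
    obtain q' where q': "q = Suc q'" using less.prems Suc by (cases q) auto
    have "coeff (kernel_moment m (Suc m + p)) q = coeff (kernel_moment m (Suc m + p')) q'"
      unfolding kernel_moment_rec[of m p] using small by (simp add: coeff_sum q' Suc)
    then show ?thesis using less.IH[of p' q'] less.prems Suc q' by simp
  qed
qed

lemma kernel_moment_sum: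
  assumes m: "m \<ge> 1" and w: "w \<noteq> 0" and card: "card (kernel_roots m w) = Suc m"
    and fin: "finite (kernel_roots m w)"
    and K: "\<And>c. c \<in> kernel_roots m w \<Longrightarrow>
      K c * (\<Prod>l\<in>kernel_roots m w - {c}. (1 + c) / c - (1 + l) / l) = 1"
  shows "(\<Sum>c\<in>kernel_roots m w. K c * inverse c ^ m * c ^ j) = poly (kernel_moment m j) w"
proof (induction j rule: less_induct)
  case (less j)
  let ?I = "kernel_roots m w"
  have nz: "c \<noteq> 0" if "c \<in> ?I" for c using kernel_root_nz(1)[OF m w that] .
  have K': "K c * (\<Prod>l\<in>?I - {c}. inverse c - inverse l) = 1" if "c \<in> ?I" for c
  proof -
    have "(\<Prod>l\<in>?I - {c}. inverse c - inverse l) = (\<Prod>l\<in>?I - {c}. (1 + c) / c - (1 + l) / l)"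
      using nz that by (intro prod.cong refl) (simp add: divide_simps algebra_simps)
    then show ?thesis using K[OF that] by simp
  qed
  show ?case
  proof (cases "j \<le> m")
    case True
    have "(\<Sum>c\<in>?I. K c * inverse c ^ m * c ^ j) = (\<Sum>c\<in>?I. K c * inverse c ^ (m - j))"
    proof (intro sum.cong refl)
      fix c assume "c \<in> ?I"
      with nz have "c \<noteq> 0" by blast
      moreover have "inverse c ^ m = inverse c ^ (m - j) * inverse c ^ j"
        using True by (simp flip: power_add)
      ultimately show "K c * inverse c ^ m * c ^ j = K c * inverse c ^ (m - j)"
        by (simp add: field_simps)
    qed
    also have "\<dots> = (if Suc (m - j) = card ?I then 1 else 0)"
      by (intro lagrange_sum fin K') (use card in auto)
    also have "\<dots> = poly (kernel_moment m j) w"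
      using True unfolding card by (subst kernel_moment.simps) auto
    finally show ?thesis .
  next
    case False
    then obtain p where p: "j = Suc m + p" by (metis add_Suc le_add_diff_inverse not_less_eq_eq)
    have "(\<Sum>c\<in>?I. K c * inverse c ^ m * c ^ j) = (\<Sum>c\<in>?I. w * (K c * inverse c ^ m * c ^ (m + p)) -
       (\<Sum>i\<le>m. of_nat (Suc m choose i) * (K c * inverse c ^ m * c ^ (p + i))))"
    proof (intro sum.cong refl)
      fix c assume "c \<in> ?I"
      then have "(1 + c) ^ Suc m = w * c ^ m" by (simp add: kernel_root_iff)
      also have "(1 + c) ^ Suc m = (\<Sum>i\<le>Suc m. of_nat (Suc m choose i) * c ^ i)"
        using binomial_ring[of c 1 "Suc m"] by (simp add: add.commute del: sum.atMost_Suc)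
      finally have "c ^ Suc m = w * c ^ m - (\<Sum>i\<le>m. of_nat (Suc m choose i) * c ^ i)"
        by (simp add: algebra_simps)
      then have "K c * inverse c ^ m * c ^ p * c ^ Suc m = K c * inverse c ^ m * c ^ p *
         (w * c ^ m - (\<Sum>i\<le>m. of_nat (Suc m choose i) * c ^ i))" by simp
      then show "K c * inverse c ^ m * c ^ j = w * (K c * inverse c ^ m * c ^ (m + p)) -
       (\<Sum>i\<le>m. of_nat (Suc m choose i) * (K c * inverse c ^ m * c ^ (p + i)))"
        by (simp add: p right_diff_distrib sum_distrib_left power_add algebra_simps)
    qed
    also have "\<dots> = w * (\<Sum>c\<in>?I. K c * inverse c ^ m * c ^ (m + p)) -
       (\<Sum>i\<le>m. of_nat (Suc m choose i) * (\<Sum>c\<in>?I. K c * inverse c ^ m * c ^ (p + i)))"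
      unfolding sum_subtractf sum_distrib_left by (subst sum.swap) (rule refl)
    also have "\<dots> = w * poly (kernel_moment m (m + p)) w -
       (\<Sum>i\<le>m. of_nat (Suc m choose i) * poly (kernel_moment m (p + i)) w)"
      using less.IH by (simp add: p)
    also have "\<dots> = poly (kernel_moment m j) w"
      unfolding p kernel_moment_rec by (simp add: poly_sum)
    finally show ?thesis .
  qed
qed

text \<open>By the kernel equation, \<open>w / (1 + 1 / u) = u (1 + 1 / u)\<^sup>m\<close>. So, up to the factor \<open>w\<close>, the sum is the sum of
the moments with the coefficients of \<open>H = h u (1 + u)\<^sup>m\<close>. As \<open>H\<close> vanishes at \<open>0\<close>, only the moments with \<open>j > m\<close>
count, and their degrees in \<open>w\<close> increase with \<open>j\<close>; so this is a nonzero polynomial in \<open>w\<close>, which is nonzero at all but finitely many points.\<close>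

lemma kernel_sum_nonzero:
  fixes h :: "complex poly"
  assumes m: "m \<ge> 1" and h: "h \<noteq> 0"
  shows "\<exists>w. generic m w \<and> (\<forall>K. (\<forall>c\<in>kernel_roots m w.
      K c * (\<Prod>l\<in>kernel_roots m w - {c}. (1 + c) / c - (1 + l) / l) = 1) \<longrightarrow>
      (\<Sum>c\<in>kernel_roots m w. K c * (c / (1 + c)) * poly h c) \<noteq> 0)"
proof -
  define H where "H = h * [:0, 1:] * [:1, 1:] ^ m"
  define P where "P = (\<Sum>j\<le>degree H. smult (coeff H j) (kernel_moment m j))"
  have degH: "degree H = Suc m + degree h"
    using h by (simp add: H_def degree_mult_eq degree_power_eq)
  have H0: "coeff H 0 = 0" by (simp add: H_def mult.assoc flip: poly_0_coeff_0)
  have "coeff P (degree h) = (\<Sum>j\<le>degree H. if j = degree H then - lead_coeff H else 0)"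
    unfolding P_def coeff_sum
  proof (intro sum.cong refl)
    fix j assume j: "j \<in> {..degree H}"
    consider "j = 0" | "0 < j" "j \<le> m" | "Suc m \<le> j" by linarith
    then show "coeff (smult (coeff H j) (kernel_moment m j)) (degree h) =
       (if j = degree H then - lead_coeff H else 0)"
    proof cases
      case 3
      then obtain p where p: "j = Suc m + p" by (metis le_Suc_ex)
      with j degH have "p \<le> degree h" by simp
      then show ?thesis using coeff_kernel_moment[OF m, of p "degree h"] p degH by auto
    qed (use H0 degH in \<open>auto simp: kernel_moment_small\<close>)
  qed
  also have "\<dots> = - lead_coeff H" by simp
  finally have "coeff P (degree h) \<noteq> 0" using h by (simp add: H_def)
  then have P: "P \<noteq> 0" by auto
  \<comment> \<open>Avoid the zeros of \<open>P\<close> and the two values of \<open>w\<close> that are not generic.\<close>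
  have "finite ({w. poly P w = 0} \<union> {0, of_nat (Suc m) ^ Suc m / of_nat m ^ m})"
    using poly_roots_finite[OF P] by simp
  then obtain w where "w \<notin> {w. poly P w = 0} \<union> {0, of_nat (Suc m) ^ Suc m / of_nat m ^ m}"
    using ex_new_if_finite[OF infinite_UNIV_char_0] by blast
  then have w: "poly P w \<noteq> 0" "generic m w"
    using m by (auto simp: generic_def field_simps)
  note dec = kernel_poly_decompose[OF m w(2)]
  have w0: "w \<noteq> 0" using w by (simp add: generic_def)
  show ?thesis
  proof (intro exI[of _ w] conjI allI impI)
    fix K assume K: "\<forall>c\<in>kernel_roots m w.
      K c * (\<Prod>l\<in>kernel_roots m w - {c}. (1 + c) / c - (1 + l) / l) = 1"
    have "w * (\<Sum>c\<in>kernel_roots m w. K c * (c / (1 + c)) * poly h c) =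
        (\<Sum>c\<in>kernel_roots m w. K c * inverse c ^ m * poly H c)"
      unfolding sum_distrib_left
    proof (intro sum.cong refl)
      fix c assume c: "c \<in> kernel_roots m w"
      have nz: "c \<noteq> 0" "1 + c \<noteq> 0" using kernel_root_nz[OF m w0 c] by auto
      have "w = (1 + c) ^ Suc m * inverse c ^ m"
        using c nz by (simp add: kernel_root_iff field_simps)
      then have *: "w * (c / (1 + c)) = inverse c ^ m * c * (1 + c) ^ m" using nz by simp
      have "w * (K c * (c / (1 + c)) * poly h c) = K c * poly h c * (w * (c / (1 + c)))"
        by (simp only: ac_simps)
      then show "w * (K c * (c / (1 + c)) * poly h c) = K c * inverse c ^ m * poly H c"
        unfolding * by (simp add: H_def poly_power)
    qed
    also have "\<dots> = (\<Sum>c\<in>kernel_roots m w. \<Sum>j\<le>degree H. coeff H j * (K c * inverse c ^ m * c ^ j))"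
      by (simp add: poly_altdef sum_distrib_left mult_ac)
    also have "\<dots> = (\<Sum>j\<le>degree H. coeff H j * (\<Sum>c\<in>kernel_roots m w. K c * inverse c ^ m * c ^ j))"
      unfolding sum_distrib_left by (rule sum.swap)
    also have "\<dots> = poly P w"
      using kernel_moment_sum[OF m w0 dec(2,1), of K] K by (simp add: P_def poly_sum)
    finally show "(\<Sum>c\<in>kernel_roots m w. K c * (c / (1 + c)) * poly h c) \<noteq> 0" using w by auto
  qed (rule w)
qed

section \<open>Evaluating the variable u at a complex number\<close>

context
  fixes h :: "'a :: comm_ring_1 \<Rightarrow> 'b :: comm_ring_1"
  assumes h0: "h 0 = 0" and hadd: "\<And>a b. h (a + b) = h a + h b"
    and hmult: "\<And>a b. h (a * b) = h a * h b"
begin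

lemma map_poly_hom_add: "map_poly h (p + q) = map_poly h p + map_poly h q"
  by (rule poly_eqI) (simp add: coeff_map_poly h0 hadd)

lemma map_poly_hom_smult: "map_poly h (smult a p) = smult (h a) (map_poly h p)"
  by (rule poly_eqI) (simp add: coeff_map_poly h0 hmult)

lemma map_poly_hom_mult: "map_poly h (p * q) = map_poly h p * map_poly h q"
proof (induction p)
  case (pCons a p)
  then show ?case
    by (simp add: map_poly_hom_add map_poly_hom_smult map_poly_pCons h0)
qed simp

end

lemmas map_poly_of_rat_hom =
  map_poly_hom_add[of "of_rat :: rat \<Rightarrow> complex", OF of_rat_0 of_rat_add of_rat_mult]
  map_poly_hom_smult[of "of_rat :: rat \<Rightarrow> complex", OF of_rat_0 of_rat_add of_rat_mult]
  map_poly_hom_mult[of "of_rat :: rat \<Rightarrow> complex", OF of_rat_0 of_rat_add of_rat_mult]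

definition eval_u :: "complex \<Rightarrow> rat poly \<Rightarrow> complex" where
  "eval_u c p = poly (map_poly of_rat p) c"

lemma eval_u_simps [simp]:
  "eval_u c 0 = 0" "eval_u c 1 = 1" "eval_u c (p + q) = eval_u c p + eval_u c q"
  "eval_u c (p * q) = eval_u c p * eval_u c q" "eval_u c (smult a p) = of_rat a * eval_u c p"
  "eval_u c (pCons a p) = of_rat a + c * eval_u c p"
  by (simp_all add: eval_u_def map_poly_of_rat_hom map_poly_pCons map_poly_1')

lemma eval_u_power [simp]: "eval_u c (p ^ n) = eval_u c p ^ n"
  by (induction n) simp_all

lemma eval_u_diff [simp]: "eval_u c (p - q) = eval_u c p - eval_u c q"
  using eval_u_simps(3)[of c "p - q" q] by simp

lemma eval_u_uminus [simp]: "eval_u c (- p) = - eval_u c p"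
  using eval_u_diff[of c 0 p] by simp

lemma eval_u_sum: "eval_u c (\<Sum>i\<in>A. f i) = (\<Sum>i\<in>A. eval_u c (f i))"
  by (induction A rule: infinite_finite_induct) simp_all

lemma eval_u_of_nat [simp]: "eval_u c (of_nat n) = of_nat n"
  by (induction n) simp_all

definition at_u :: "complex \<Rightarrow> rat poly fps \<Rightarrow> complex fps" where
  "at_u c g = Abs_fps (\<lambda>n. eval_u c (g $ n))"

lemma at_u_nth [simp]: "at_u c g $ n = eval_u c (g $ n)"
  by (simp add: at_u_def)

lemma at_u_simps [simp]:
  "at_u c 0 = 0" "at_u c 1 = 1" "at_u c (f + g) = at_u c f + at_u c g"
  "at_u c (f - g) = at_u c f - at_u c g"
  "at_u c (f * g) = at_u c f * at_u c g" "at_u c (fps_const p) = fps_const (eval_u c p)"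
  "at_u c fps_X = fps_X"
  by (rule fps_ext; simp add: fps_mult_nth eval_u_sum fps_X_def)+

lemma of_rat_fact: "of_rat (fact n) = (fact n :: complex)"
  by (metis of_rat_of_nat_eq of_nat_fact)

lemma at_u_exp_z [simp]: "at_u c (exp_z p) = fps_exp (eval_u c p)"
  by (rule fps_ext) (simp add: exp_z_def of_rat_divide of_rat_fact)

lemma exp_z_add: "exp_z (p + q) = exp_z p * exp_z q"
proof (rule fps_ext)
  fix n
  have "smult (1 / fact n) ((p + q) ^ n) =
      (\<Sum>k\<le>n. smult (1 / fact n) (of_nat (n choose k) * p ^ k * q ^ (n - k)))"
    unfolding binomial_ring by (rule poly_eqI) (simp add: coeff_sum sum_distrib_left)
  also have "\<dots> = (\<Sum>k\<le>n. smult (1 / fact k) (p ^ k) * smult (1 / fact (n - k)) (q ^ (n - k)))"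
  proof (intro sum.cong refl)
    fix k assume "k \<in> {..n}"
    then have c: "1 / fact n * rat_of_nat (n choose k) = 1 / fact k * (1 / fact (n - k))"
      by (simp add: binomial_fact)
    have "of_nat (n choose k) * p ^ k * q ^ (n - k) = smult (rat_of_nat (n choose k)) (p ^ k * q ^ (n - k))"
      by (simp add: of_nat_poly)
    then show "smult (1 / fact n) (of_nat (n choose k) * p ^ k * q ^ (n - k)) =
       smult (1 / fact k) (p ^ k) * smult (1 / fact (n - k)) (q ^ (n - k))"
      using c by (simp add: mult.commute)
  qed
  finally show "exp_z (p + q) $ n = (exp_z p * exp_z q) $ n"
    by (simp add: exp_z_def fps_mult_nth atLeast0AtMost)
qed

section \<open>Power series that agree up to a given order\<close>

definition agree :: "nat \<Rightarrow> 'a fps \<Rightarrow> 'a :: zero fps \<Rightarrow> bool" where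
  "agree n f g \<longleftrightarrow> (\<forall>i<n. f $ i = g $ i)"

lemma agree_refl: "agree n f f"
  by (simp add: agree_def)

lemma agree_less: "agree n f g \<Longrightarrow> k \<le> n \<Longrightarrow> agree k f g"
  by (simp add: agree_def)

lemma agree_mult: "agree n f f' \<Longrightarrow> agree n g g' \<Longrightarrow> agree n (f * g) (f' * g' :: 'a :: semiring_0 fps)"
  by (auto simp: agree_def fps_mult_nth intro!: sum.cong)

lemma agree_X: "agree n f g \<Longrightarrow> agree (Suc n) (fps_X * f) (fps_X * g :: 'a :: semiring_1 fps)"
  by (auto simp: agree_def)

text \<open>The order of a product is the sum of the orders, and \<open>d\<close> has order \<open>0\<close>.\<close>

lemma agree_cancel:
  fixes d :: "'a :: idom fps"
  assumes "agree n (d * f) (d * g)" "d $ 0 \<noteq> 0"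
  shows "agree n f g"
proof (cases "f = g")
  case False
  have "d \<noteq> 0" "subdegree d = 0" using assms(2) by (auto simp: subdegree_eq_0_iff)
  then have "subdegree (d * (f - g)) = subdegree (f - g)" "d * (f - g) \<noteq> 0" using False by simp_all
  moreover have "subdegree (d * (f - g)) \<ge> n"
    using calculation(2) assms(1) by (intro subdegree_geI) (auto simp: agree_def right_diff_distrib)
  ultimately have "(f - g) $ i = 0" if "i < n" for i
    using that by (intro nth_less_subdegree_zero) simp
  then show ?thesis by (simp add: agree_def)
qed (simp add: agree_refl)

section \<open>The linearised recursion\<close>

text \<open>The value at \<open>u = 0\<close>, kept in the same ring. As \<open>u = 0\<close> means \<open>x = 1\<close>, it is what a divided difference
subtracts.\<close>

definition at_0 :: "rat poly fps \<Rightarrow> rat poly fps" where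
  "at_0 g = Abs_fps (\<lambda>n. [:coeff (g $ n) 0:])"

lemma divide_u_at_0: "fps_const [:0, 1:] * divide_u (g - at_0 g) = g - at_0 g"
proof (rule fps_ext)
  fix n
  have "[:0, 1:] * (p div [:0, 1:]) = p" if "coeff p 0 = 0" for p :: "rat poly"
  proof -
    have "[:0, 1:] dvd p" using that by (cases p) (auto intro: dvdI)
    then show ?thesis by (rule dvd_mult_div_cancel)
  qed
  then show "(fps_const [:0, 1:] * divide_u (g - at_0 g)) $ n = (g - at_0 g) $ n"
    unfolding fps_mult_left_const_nth divide_u_def fps_nth_Abs_fps by (simp add: at_0_def)
qed

lemma eval_u_const: "eval_u c [:coeff p 0:] = eval_u 0 p"
  by (cases p) simp

lemma at_u_at_0 [simp]: "at_u c (at_0 g) = at_u 0 g"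
  by (rule fps_ext) (simp only: at_u_nth at_0_def fps_nth_Abs_fps eval_u_const)

definition closed_form :: "nat \<Rightarrow> rat poly fps" where
  "closed_form m = fps_const [:1, 1:] * exp_z [:of_nat m + 1, - (of_nat m - 1):] *
     (1 + divide_u (1 - exp_z [:0, of_nat m:]))"

text \<open>The closed form divided by \<open>(x - 1) / u\<close>. The closed form enters the recursion only through this
quotient, which is much simpler than the closed form itself.\<close>

definition closed_form_quotient :: "nat \<Rightarrow> rat poly fps" where
  "closed_form_quotient m = fps_const [:1, 1:] * exp_z [:of_nat m + 1, 1:]"

lemma closed_form_quotient: "fps_const [:0, 1:] * closed_form m = (x_series m - 1) * closed_form_quotient m"
proof -
  have u: "fps_const [:0, 1:] * (1 + divide_u (1 - exp_z [:0, of_nat m:])) =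
      fps_const [:1, 1:] - exp_z [:0, rat_of_nat m:]"
    unfolding distrib_left divide_u_exact by (simp add: fps_eq_iff one_pCons)
  have e1: "exp_z [:of_nat m + 1, - (of_nat m - 1):] * exp_z [:0, rat_of_nat m:] = exp_z [:of_nat m + 1, 1:]"
    unfolding exp_z_add[symmetric] by simp
  have e2: "exp_z [:0, - rat_of_nat m:] * exp_z [:of_nat m + 1, 1:] = exp_z [:of_nat m + 1, - (of_nat m - 1):]"
    unfolding exp_z_add[symmetric] by simp
  have "fps_const [:0, 1:] * closed_form m = fps_const [:1, 1:] *
      exp_z [:of_nat m + 1, - (of_nat m - 1):] * (fps_const [:1, 1:] - exp_z [:0, rat_of_nat m:])"
    unfolding closed_form_def u[symmetric] by (simp only: ac_simps)
  also have "\<dots> = fps_const [:1, 1:] * (fps_const [:1, 1:] * exp_z [:of_nat m + 1, - (of_nat m - 1):] -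
      exp_z [:of_nat m + 1, 1:])"
    unfolding e1[symmetric] by (simp only: right_diff_distrib ac_simps)
  also have "\<dots> = (x_series m - 1) * closed_form_quotient m"
    unfolding e2[symmetric] x_series_def closed_form_quotient_def
    by (simp only: left_diff_distrib right_diff_distrib mult_1_left ac_simps)
  finally show ?thesis .
qed

text \<open>The operator \<open>g \<mapsto> G \<Delta> g\<close>, for the closed form \<open>G\<close>, in terms of the variable \<open>u\<close>.\<close>

definition kernel_op :: "nat \<Rightarrow> rat poly fps \<Rightarrow> rat poly fps" where
  "kernel_op m g = closed_form_quotient m * divide_u (g - at_0 g)"

lemma agree_divide_u: "agree n f g \<Longrightarrow> agree n (divide_u f) (divide_u g)"
  by (simp add: agree_def divide_u_def)

lemma agree_kernel_op: "agree n f g \<Longrightarrow> agree n (kernel_op m f) (kernel_op m g)"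
  unfolding kernel_op_def
  by (intro agree_mult agree_refl agree_divide_u) (simp add: agree_def at_0_def)

lemma agree_kernel_op_power: "agree n f g \<Longrightarrow> agree n ((kernel_op m ^^ j) f) ((kernel_op m ^^ j) g)"
  by (induction j) (auto intro: agree_kernel_op)

lemma kernel_op_0: "(kernel_op m ^^ j) 0 = 0"
proof (induction j)
  case (Suc j)
  have "divide_u 0 = 0" "at_0 0 = 0" by (simp_all add: divide_u_def at_0_def fps_eq_iff)
  then show ?case using Suc by (simp add: kernel_op_def)
qed simp

text \<open>The substituted recursion for the \<open>F\<^sub>k\<close>, with the closed form in place of \<open>F\<close>.\<close>

primrec rise_series :: "nat \<Rightarrow> nat \<Rightarrow> rat poly fps" where
  "rise_series m 0 = x_series m"
| "rise_series m (Suc k) = fps_const [:1 / of_nat (Suc k):] * t_series m * x_series m *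
     (kernel_op m ^^ m) (rise_series m k)"

lemma agree_t_series:
  "agree n f g \<Longrightarrow> agree (Suc n) (fps_const a * t_series m * b * f) (fps_const a * t_series m * b * g)"
  using agree_X[OF agree_mult[OF agree_refl, of n f g "fps_const a * exp_z [:- of_nat (m * (m + 1)):] * b"]]
  unfolding t_series_def by (simp only: ac_simps)

lemma rise_series_order: "agree k (rise_series m k) 0"
proof (induction k)
  case (Suc k)
  from agree_kernel_op_power[OF Suc, of m m] have "agree k ((kernel_op m ^^ m) (rise_series m k)) 0"
    by (simp add: kernel_op_0)
  from agree_t_series[OF this] show ?case by simp
qed (simp add: agree_def)

lemma rise_series_factor: "\<exists>h. rise_series m k = fps_const [:1, 1:] * h"
proof (cases k)
  case 0
  then show ?thesis by (auto simp: x_series_def)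
next
  case (Suc k')
  have "rise_series m k = fps_const [:1, 1:] * (fps_const [:1 / of_nat (Suc k'):] * t_series m *
     exp_z [:0, - of_nat m:] * (kernel_op m ^^ m) (rise_series m k'))"
    unfolding Suc rise_series.simps x_series_def by (simp only: ac_simps)
  then show ?thesis by blast
qed

definition rise_total :: "nat \<Rightarrow> rat poly fps" where
  "rise_total m = Abs_fps (\<lambda>n. \<Sum>k\<le>n. rise_series m k $ n)"

lemma rise_total_factor: "\<exists>h. rise_total m = fps_const [:1, 1:] * h"
proof -
  obtain h where h: "\<And>k. rise_series m k = fps_const [:1, 1:] * h k"
    using rise_series_factor by metis
  have "rise_total m = fps_const [:1, 1:] * Abs_fps (\<lambda>n. \<Sum>k\<le>n. h k $ n)"
    by (rule fps_ext) (simp only: rise_total_def fps_nth_Abs_fps h fps_mult_left_const_nth sum_distrib_left)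
  then show ?thesis by blast
qed

section \<open>A functional that diagonalises the recursion\<close>

lemma fps_nth_0_prod: "(\<Prod>l\<in>A. f l) $ 0 = (\<Prod>l\<in>A. f l $ 0 :: 'b :: comm_ring_1)"
  by (induction A rule: infinite_finite_induct) simp_all

lemma prod_fps_exp: "finite A \<Longrightarrow> (\<Prod>c\<in>A. fps_const (f c) * fps_exp (g c)) =
   fps_const (\<Prod>c\<in>A. f c) * fps_exp (\<Sum>c\<in>A. g c :: complex)"
proof (induction A rule: finite_induct)
  case (insert a A)
  then show ?case
    by (simp add: fps_exp_add_mult fps_const_mult[symmetric] ac_simps del: fps_const_mult)
qed simp

text \<open>The value of \<open>v\<close> at \<open>u = c\<close>.\<close>

definition branch :: "complex \<Rightarrow> complex fps" where
  "branch c = fps_const ((1 + c) / c) * fps_exp c"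

text \<open>The inverse of \<open>branch\<close> when \<open>c\<close> is neither \<open>0\<close> nor \<open>-1\<close>.\<close>

definition branch_inv :: "complex \<Rightarrow> complex fps" where
  "branch_inv c = fps_const (c / (1 + c)) * fps_exp (- c)"

lemma branch_power: "branch c ^ k = fps_const (((1 + c) / c) ^ k) * fps_exp (of_nat k * c)"
  by (simp add: branch_def power_mult_distrib fps_exp_power_mult)

lemma at_u_x_series: "at_u c (x_series m) = fps_const (1 + c) * fps_exp (- (of_nat m * c))"
  by (simp add: x_series_def of_rat_minus mult.commute)

lemma at_u_t_series: "at_u c (t_series m) * fps_exp (of_nat m + 1) ^ m = fps_X"
proof -
  have "at_u c (t_series m) * fps_exp (of_nat m + 1) ^ m = fps_X * (fps_exp (- of_nat (m * (m + 1))) * fps_exp (of_nat m * (of_nat m + 1)))"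
    by (simp add: t_series_def fps_exp_power_mult mult.assoc of_rat_minus of_rat_mult of_rat_add of_rat_diff)
  also have "\<dots> = fps_X" unfolding fps_exp_add_mult[symmetric] by (simp add: algebra_simps)
  finally show ?thesis .
qed

context
  fixes m :: nat and w :: complex
  assumes m: "m \<ge> 1" and w: "generic m w"
begin

abbreviation roots where "roots \<equiv> kernel_roots m w"

text \<open>The inverse of the value of \<open>x\<close> at \<open>u = c\<close> when \<open>c\<close> is not \<open>-1\<close>.\<close>

definition x_inv :: "complex \<Rightarrow> complex fps" where
  "x_inv c = fps_const (1 / (1 + c)) * fps_exp (of_nat m * c)"

definition lagrange_weight :: "complex \<Rightarrow> complex fps" where
  "lagrange_weight c = inverse (\<Prod>l\<in>roots - {c}. branch c - branch l)"

abbreviation exp_base :: "complex fps" where "exp_base \<equiv> fps_exp (of_nat m + 1)"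

lemma finite_roots: "finite roots" and card_roots: "card roots = Suc m"
  using kernel_poly_decompose[OF m w] by auto

lemma w_nonzero: "w \<noteq> 0" using w by (simp add: generic_def)

lemma root_nonzero: "c \<in> roots \<Longrightarrow> c \<noteq> 0" "c \<in> roots \<Longrightarrow> 1 + c \<noteq> 0"
  using kernel_root_nz[OF m w_nonzero] by auto

text \<open>The roots are distinct, and hence so are the constant terms of the values of \<open>v\<close>.\<close>

lemma lagrange_weight: "c \<in> roots \<Longrightarrow> lagrange_weight c * (\<Prod>l\<in>roots - {c}. branch c - branch l) = 1"
proof -
  assume c: "c \<in> roots"
  have "branch c $ 0 - branch l $ 0 \<noteq> 0" if "l \<in> roots - {c}" for l
    using that c root_nonzero by (auto simp: branch_def field_simps)
  then have "(\<Prod>l\<in>roots - {c}. branch c - branch l) $ 0 \<noteq> 0"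
    using finite_roots by (simp add: fps_nth_0_prod)
  then show ?thesis unfolding lagrange_weight_def by (rule inverse_mult_eq_1)
qed

lemma lagrange_weight_0: "c \<in> roots \<Longrightarrow> lagrange_weight c $ 0 * (\<Prod>l\<in>roots - {c}. (1 + c) / c - (1 + l) / l) = 1"
  using arg_cong[OF lagrange_weight[of c], of "\<lambda>f. f $ 0"] by (simp add: fps_nth_0_prod branch_def)

lemma branch_inv: "c \<in> roots \<Longrightarrow> branch_inv c * branch c = 1"
proof -
  assume c: "c \<in> roots"
  have "branch_inv c * branch c = fps_const (c / (1 + c) * ((1 + c) / c)) * (fps_exp (- c) * fps_exp c)"
    unfolding branch_inv_def branch_def by (simp only: fps_const_mult[symmetric] ac_simps)
  then show ?thesis using root_nonzero[OF c] by (simp flip: fps_exp_add_mult)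
qed

lemma x_inv: "c \<in> roots \<Longrightarrow> x_inv c * at_u c (x_series m) = 1"
proof -
  assume c: "c \<in> roots"
  have "x_inv c * at_u c (x_series m) = fps_const (1 / (1 + c) * (1 + c)) *
     (fps_exp (of_nat m * c) * fps_exp (- (of_nat m * c)))"
    unfolding x_inv_def at_u_x_series by (simp only: fps_const_mult[symmetric] ac_simps)
  then show ?thesis using root_nonzero[OF c] by (simp flip: fps_exp_add_mult)
qed

lemma x_branch_power: "c \<in> roots \<Longrightarrow> branch c ^ m * at_u c (x_series m) = fps_const w"
proof -
  assume c: "c \<in> roots"
  have "(1 + c) ^ Suc m = w * c ^ m" using c by (simp only: kernel_root_iff)
  then have e: "((1 + c) / c) ^ m * (1 + c) = w" using root_nonzero[OF c] by (simp add: field_simps)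
  have "branch c ^ m * at_u c (x_series m) = fps_const (((1 + c) / c) ^ m * (1 + c)) *
     (fps_exp (of_nat m * c) * fps_exp (- (of_nat m * c)))"
    unfolding branch_power at_u_x_series by (simp only: fps_const_mult[symmetric] ac_simps)
  then show ?thesis unfolding e by (simp flip: fps_exp_add_mult)
qed

lemma at_u_kernel_op:
  assumes "c \<in> roots"
  shows "at_u c (kernel_op m g) = exp_base * branch c * (at_u c g - at_u 0 g)"
proof -
  have "fps_const c * at_u c (divide_u (g - at_0 g)) = at_u c g - at_u 0 g"
    using arg_cong[OF divide_u_at_0[of g], of "at_u c"] by simp
  then have "fps_const (inverse c) * (at_u c g - at_u 0 g) =
      fps_const (inverse c * c) * at_u c (divide_u (g - at_0 g))"
    unfolding fps_const_mult[symmetric] by (simp only: mult.assoc)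
  then have d: "at_u c (divide_u (g - at_0 g)) = fps_const (inverse c) * (at_u c g - at_u 0 g)"
    using root_nonzero[OF assms] by simp
  have "at_u c (kernel_op m g) = fps_const (1 + c) * fps_exp (of_nat m + 1 + c) *
      (fps_const (inverse c) * (at_u c g - at_u 0 g))"
    by (simp add: kernel_op_def closed_form_quotient_def d of_rat_add)
  also have "\<dots> = exp_base * branch c * (at_u c g - at_u 0 g)"
    unfolding branch_def divide_inverse fps_const_mult[symmetric] fps_exp_add_mult[of "of_nat m + 1" c]
    by (simp only: ac_simps)
  finally show ?thesis .
qed

text \<open>At a root, \<open>kernel_op\<close> is multiplication by \<open>v\<close>, up to a factor that is the same at all roots and a correction by the
value at \<open>0\<close>. Iterating it gives a polynomial in \<open>v\<close> with coefficients that do not depend on the root.\<close>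

lemma at_u_kernel_op_power:
  assumes "c \<in> roots"
  shows "at_u c ((kernel_op m ^^ j) g) = (exp_base * branch c) ^ j * at_u c g -
     (\<Sum>i<j. (exp_base * branch c) ^ (j - i) * at_u 0 ((kernel_op m ^^ i) g))"
proof (induction j)
  case (Suc j)
  have "at_u c ((kernel_op m ^^ Suc j) g) = exp_base * branch c *
     ((exp_base * branch c) ^ j * at_u c g - (\<Sum>i<j. (exp_base * branch c) ^ (j - i) * at_u 0 ((kernel_op m ^^ i) g)) -
      at_u 0 ((kernel_op m ^^ j) g))"
    using at_u_kernel_op[OF assms, of "(kernel_op m ^^ j) g"] Suc by simp
  also have "\<dots> = (exp_base * branch c) ^ Suc j * at_u c g -
     (\<Sum>i<j. exp_base * branch c * ((exp_base * branch c) ^ (j - i) * at_u 0 ((kernel_op m ^^ i) g))) -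
      exp_base * branch c * at_u 0 ((kernel_op m ^^ j) g)"
    unfolding right_diff_distrib sum_distrib_left by (simp only: power_Suc mult.assoc)
  also have "(\<Sum>i<j. exp_base * branch c * ((exp_base * branch c) ^ (j - i) * at_u 0 ((kernel_op m ^^ i) g))) =
      (\<Sum>i<j. (exp_base * branch c) ^ (Suc j - i) * at_u 0 ((kernel_op m ^^ i) g))"
    by (intro sum.cong refl) (simp add: Suc_diff_le less_imp_le mult.assoc)
  finally show ?case by simp
qed simp

definition functional :: "rat poly fps \<Rightarrow> complex fps" where
  "functional g = (\<Sum>c\<in>roots. lagrange_weight c * branch_inv c * x_inv c * at_u c g)"

text \<open>The leading term \<open>v\<^sup>m\<close> combines with \<open>x\<close> to the constant \<open>w\<close>. After division by \<open>v\<close>, the other terms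
are powers of \<open>v\<close> with exponent below \<open>m\<close>, and their Lagrange sums vanish.\<close>

lemma functional_step:
  "functional (fps_const [:a:] * t_series m * x_series m * (kernel_op m ^^ m) g) =
     fps_const (of_rat a * w) * fps_X * functional g"
proof -
  let ?t = "\<lambda>c. at_u c (t_series m)"
  let ?a = "\<lambda>i. at_u 0 ((kernel_op m ^^ i) g)"
  have t: "?t c = ?t 0" for c by (simp add: t_series_def)
  have "functional (fps_const [:a:] * t_series m * x_series m * (kernel_op m ^^ m) g) =
     (\<Sum>c\<in>roots. fps_const (of_rat a * w) * fps_X * (lagrange_weight c * branch_inv c * x_inv c * at_u c g) -
       (\<Sum>i<m. fps_const (of_rat a) * ?t 0 * exp_base ^ (m - i) * ?a i * (lagrange_weight c * branch c ^ (m - Suc i))))"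
    unfolding functional_def
  proof (intro sum.cong refl)
    fix c assume c: "c \<in> roots"
    have "lagrange_weight c * branch_inv c * x_inv c * at_u c (fps_const [:a:] * t_series m * x_series m * (kernel_op m ^^ m) g)
      = (x_inv c * at_u c (x_series m)) * lagrange_weight c * branch_inv c * fps_const (of_rat a) * ?t c *
         at_u c ((kernel_op m ^^ m) g)"
      by (simp add: ac_simps)
    also have "\<dots> = lagrange_weight c * branch_inv c * fps_const (of_rat a) * ?t c * at_u c ((kernel_op m ^^ m) g)"
      unfolding x_inv[OF c] by simp
    also have "\<dots> = lagrange_weight c * branch_inv c * fps_const (of_rat a) * ?t c * ((exp_base * branch c) ^ m * at_u c g) -
       (\<Sum>i<m. lagrange_weight c * branch_inv c * fps_const (of_rat a) * ?t c * ((exp_base * branch c) ^ (m - i) * ?a i))"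
      unfolding at_u_kernel_op_power[OF c] right_diff_distrib sum_distrib_left ..
    also have "lagrange_weight c * branch_inv c * fps_const (of_rat a) * ?t c * ((exp_base * branch c) ^ m * at_u c g) =
       fps_const (of_rat a) * (?t c * exp_base ^ m) * (branch c ^ m) * (lagrange_weight c * branch_inv c * at_u c g) * 1"
      unfolding power_mult_distrib mult_1_right by (simp only: ac_simps)
    also have "\<dots> = fps_const (of_rat a) * (?t c * exp_base ^ m) * (branch c ^ m) * (lagrange_weight c * branch_inv c * at_u c g) *
       (x_inv c * at_u c (x_series m))"
      unfolding x_inv[OF c] ..
    also have "\<dots> = fps_const (of_rat a) * (branch c ^ m * at_u c (x_series m)) * (?t c * exp_base ^ m) *
        (lagrange_weight c * branch_inv c * x_inv c * at_u c g)"
      by (simp only: ac_simps)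
    also have "\<dots> = fps_const (of_rat a * w) * fps_X * (lagrange_weight c * branch_inv c * x_inv c * at_u c g)"
      unfolding at_u_t_series x_branch_power[OF c] by simp
    also have "(\<Sum>i<m. lagrange_weight c * branch_inv c * fps_const (of_rat a) * ?t c * ((exp_base * branch c) ^ (m - i) * ?a i)) =
       (\<Sum>i<m. fps_const (of_rat a) * ?t 0 * exp_base ^ (m - i) * ?a i * (lagrange_weight c * branch c ^ (m - Suc i)))"
    proof (intro sum.cong refl)
      fix i assume "i \<in> {..<m}"
      then have "branch c ^ (m - i) = branch c * branch c ^ (m - Suc i)"
        by (metis Suc_diff_Suc lessThan_iff power_Suc)
      then have "lagrange_weight c * branch_inv c * fps_const (of_rat a) * ?t c * ((exp_base * branch c) ^ (m - i) * ?a i) =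
         fps_const (of_rat a) * ?t c * exp_base ^ (m - i) * ?a i * ((branch_inv c * branch c) * lagrange_weight c * branch c ^ (m - Suc i))"
        unfolding power_mult_distrib by (simp only: ac_simps)
      then show "lagrange_weight c * branch_inv c * fps_const (of_rat a) * ?t c * ((exp_base * branch c) ^ (m - i) * ?a i) =
         fps_const (of_rat a) * ?t 0 * exp_base ^ (m - i) * ?a i * (lagrange_weight c * branch c ^ (m - Suc i))"
        unfolding branch_inv[OF c] t[of c] by simp
    qed
    finally show "lagrange_weight c * branch_inv c * x_inv c * at_u c (fps_const [:a:] * t_series m * x_series m * (kernel_op m ^^ m) g)
       = fps_const (of_rat a * w) * fps_X * (lagrange_weight c * branch_inv c * x_inv c * at_u c g) -
       (\<Sum>i<m. fps_const (of_rat a) * ?t 0 * exp_base ^ (m - i) * ?a i * (lagrange_weight c * branch c ^ (m - Suc i)))" .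
  qed
  also have "\<dots> = fps_const (of_rat a * w) * fps_X * functional g -
     (\<Sum>i<m. fps_const (of_rat a) * ?t 0 * exp_base ^ (m - i) * ?a i * (\<Sum>c\<in>roots. lagrange_weight c * branch c ^ (m - Suc i)))"
    unfolding sum_subtractf functional_def sum_distrib_left by (subst sum.swap) (rule refl)
  also have "(\<Sum>i<m. fps_const (of_rat a) * ?t 0 * exp_base ^ (m - i) * ?a i * (\<Sum>c\<in>roots. lagrange_weight c * branch c ^ (m - Suc i))) = 0"
  proof (intro sum.neutral ballI)
    fix i assume "i \<in> {..<m}"
    then have "(\<Sum>c\<in>roots. lagrange_weight c * branch c ^ (m - Suc i)) = 0"
      using lagrange_sum[OF finite_roots, of lagrange_weight branch "m - Suc i"] lagrange_weight card_roots by auto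
    then show "fps_const (of_rat a) * ?t 0 * exp_base ^ (m - i) * ?a i * (\<Sum>c\<in>roots. lagrange_weight c * branch c ^ (m - Suc i)) = 0"
      by simp
  qed
  finally show ?thesis by simp
qed

text \<open>Only \<open>\<Prod> 1 / v\<^sub>i\<close> is left, and the kernel polynomial supplies \<open>\<Prod> u\<^sub>i\<close>, \<open>\<Prod> (1 + u\<^sub>i)\<close> and
\<open>\<Sum> u\<^sub>i\<close>.\<close>

lemma functional_x_series: "functional (x_series m) = fps_const (- 1 / w) * fps_exp (of_nat m + 1 - w)"
proof -
  note vieta = kernel_vieta[OF m w]
  have "functional (x_series m) = (\<Sum>c\<in>roots. lagrange_weight c * branch_inv c)"
    unfolding functional_def using x_inv by (intro sum.cong refl) (simp add: mult.assoc)
  also have "\<dots> = (-1) ^ m * (\<Prod>c\<in>roots. branch_inv c)"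
    using lagrange_sum_inverse[OF finite_roots, of lagrange_weight branch branch_inv] lagrange_weight branch_inv card_roots by fastforce
  also have "(\<Prod>c\<in>roots. branch_inv c) = fps_const (\<Prod>c\<in>roots. c / (1 + c)) * fps_exp (\<Sum>c\<in>roots. - c)"
    unfolding branch_inv_def by (rule prod_fps_exp[OF finite_roots])
  also have "(\<Prod>c\<in>roots. c / (1 + c)) = (-1) ^ Suc m / w"
    unfolding prod_dividef vieta ..
  also have "(\<Sum>c\<in>roots. - c) = of_nat m + 1 - w"
    unfolding sum_negf vieta by simp
  also have "(-1) ^ m * (fps_const ((-1) ^ Suc m / w) * fps_exp (of_nat m + 1 - w)) =
      fps_const (- 1 / w) * fps_exp (of_nat m + 1 - w)"
  proof -
    have "(-1 :: complex fps) ^ m = fps_const ((-1) ^ m)"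
      by (simp flip: fps_const_power fps_const_neg)
    moreover have "(-1) ^ m * ((-1) ^ Suc m / w) = - 1 / w"
      by (cases "even m") simp_all
    ultimately show ?thesis unfolding mult.assoc[symmetric] by simp
  qed
  finally show ?thesis .
qed

lemma functional_rise_series:
  "functional (rise_series m k) = fps_const (w ^ k / fact k) * fps_X ^ k * functional (x_series m)"
proof (induction k)
  case (Suc k)
  have "functional (rise_series m (Suc k)) = fps_const (of_rat (1 / of_nat (Suc k)) * w) * fps_X *
     functional (rise_series m k)"
    unfolding rise_series.simps by (rule functional_step)
  also have "\<dots> = fps_const (of_rat (1 / of_nat (Suc k)) * w * (w ^ k / fact k)) * fps_X ^ Suc k *
     functional (x_series m)"
    unfolding Suc fps_const_mult[symmetric] power_Suc by (simp only: ac_simps)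
  also have "of_rat (1 / of_nat (Suc k)) * w * (w ^ k / fact k) = w ^ Suc k / fact (Suc k)"
    by (simp add: of_rat_divide of_rat_add)
  finally show ?case .
qed simp

lemma functional_agree:
  assumes "agree n f g"
  shows "agree n (functional f) (functional g)"
proof -
  have "agree n (at_u c f) (at_u c g)" for c using assms by (simp add: agree_def)
  then have "agree n (lagrange_weight c * branch_inv c * x_inv c * at_u c f) (lagrange_weight c * branch_inv c * x_inv c * at_u c g)" for c
    by (intro agree_mult agree_refl)
  then show ?thesis unfolding functional_def agree_def by (auto simp: fps_sum_nth intro!: sum.cong)
qed

lemma functional_add: "functional (f + g) = functional f + functional g"
  by (simp add: functional_def distrib_left sum.distrib)

lemma functional_diff: "functional (f - g) = functional f - functional g"
  by (simp add: functional_def right_diff_distrib sum_subtractf)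

lemma functional_sum: "functional (\<Sum>i\<in>A. f i) = (\<Sum>i\<in>A. functional (f i))"
proof (induction A rule: infinite_finite_induct)
qed (simp_all add: functional_add, simp_all add: functional_def)

lemma functional_rise_total: "functional (rise_total m) = fps_const (- 1 / w) * exp_base"
proof -
  have "functional (rise_total m) = fps_exp w * functional (x_series m)"
  proof (rule fps_ext)
    fix n
    have "agree (Suc n) (rise_total m) (\<Sum>k\<le>n. rise_series m k)"
      unfolding agree_def
    proof (intro allI impI)
      fix i assume "i < Suc n"
      then have "(\<Sum>k\<le>n. rise_series m k $ i) = (\<Sum>k\<le>i. rise_series m k $ i)"
        using rise_series_order by (intro sum.mono_neutral_right) (auto simp: agree_def)
      then show "rise_total m $ i = (\<Sum>k\<le>n. rise_series m k) $ i"
        by (simp add: rise_total_def fps_sum_nth)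
    qed
    from functional_agree[OF this] have "functional (rise_total m) $ n =
        (\<Sum>k\<le>n. functional (rise_series m k) $ n)"
      by (simp add: agree_def functional_sum fps_sum_nth)
    also have "\<dots> = (\<Sum>k\<le>n. w ^ k / fact k * functional (x_series m) $ (n - k))"
      unfolding functional_rise_series by (intro sum.cong refl) (simp add: mult.assoc fps_X_power_mult_nth)
    finally show "functional (rise_total m) $ n = (fps_exp w * functional (x_series m)) $ n"
      by (simp add: fps_mult_nth atLeast0AtMost)
  qed
  also have "\<dots> = fps_const (- 1 / w) * (fps_exp w * fps_exp (of_nat m + 1 - w))"
    unfolding functional_x_series by (simp only: ac_simps)
  finally show ?thesis by (simp flip: fps_exp_add_mult)
qed

text \<open>At the roots, the closed form divided by \<open>x v\<close> is \<open>e\<^sup>(\<^sup>m\<^sup>+\<^sup>1\<^sup>)\<^sup>z (1 - v\<^sup>m / w)\<close>, and the Lagrange sums of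
\<open>1\<close> and \<open>v\<^sup>m\<close> are \<open>0\<close> and \<open>1\<close>.\<close>

lemma functional_closed_form: "functional (closed_form m) = fps_const (- 1 / w) * exp_base"
proof -
  have "functional (closed_form m) = (\<Sum>c\<in>roots. exp_base * (lagrange_weight c * branch c ^ 0) - fps_const (1 / w) * exp_base * (lagrange_weight c * branch c ^ m))"
    unfolding functional_def
  proof (intro sum.cong refl)
    fix c assume c: "c \<in> roots"
    have "at_u c (fps_const [:0, 1:] * closed_form m) = at_u c ((x_series m - 1) * closed_form_quotient m)"
      by (simp only: closed_form_quotient)
    then have g: "fps_const c * at_u c (closed_form m) =
        (at_u c (x_series m) - 1) * (fps_const (1 + c) * fps_exp (of_nat m + 1 + c))"
      by (simp add: closed_form_quotient_def of_rat_add)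
    have "fps_const (inverse c) * (fps_const c * at_u c (closed_form m)) = at_u c (closed_form m)"
      using root_nonzero[OF c] by (simp flip: mult.assoc)
    then have "at_u c (closed_form m) = (at_u c (x_series m) - 1) *
        (fps_const (inverse c) * (fps_const (1 + c) * fps_exp (of_nat m + 1 + c)))"
      unfolding g by (simp only: ac_simps)
    also have "fps_const (inverse c) * (fps_const (1 + c) * fps_exp (of_nat m + 1 + c)) = exp_base * branch c"
      unfolding branch_def divide_inverse fps_const_mult[symmetric] fps_exp_add_mult[of "of_nat m + 1" c]
      by (simp only: ac_simps)
    finally have g': "at_u c (closed_form m) = (at_u c (x_series m) - 1) * (exp_base * branch c)" .
    have "branch c ^ m * at_u c (x_series m) * x_inv c = fps_const w * x_inv c"
      unfolding x_branch_power[OF c] ..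
    then have "branch c ^ m * (x_inv c * at_u c (x_series m)) = fps_const w * x_inv c"
      by (simp only: ac_simps)
    then have "branch c ^ m = fps_const w * x_inv c" unfolding x_inv[OF c] by simp
    then have "fps_const (1 / w) * branch c ^ m = fps_const (1 / w * w) * x_inv c"
      unfolding fps_const_mult[symmetric] by (simp only: mult.assoc)
    then have ix: "x_inv c = fps_const (1 / w) * branch c ^ m" using w_nonzero by simp
    have "lagrange_weight c * branch_inv c * x_inv c * at_u c (closed_form m) =
       (lagrange_weight c * exp_base) * (branch_inv c * branch c) * (x_inv c * at_u c (x_series m)) - (lagrange_weight c * exp_base) * (branch_inv c * branch c) * x_inv c"
      unfolding g' by (simp only: left_diff_distrib right_diff_distrib mult_1_left ac_simps)
    also have "\<dots> = exp_base * (lagrange_weight c * branch c ^ 0) - fps_const (1 / w) * exp_base * (lagrange_weight c * branch c ^ m)"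
      unfolding branch_inv[OF c] x_inv[OF c] unfolding ix by (simp add: ac_simps)
    finally show "lagrange_weight c * branch_inv c * x_inv c * at_u c (closed_form m) =
       exp_base * (lagrange_weight c * branch c ^ 0) - fps_const (1 / w) * exp_base * (lagrange_weight c * branch c ^ m)" .
  qed
  also have "\<dots> = exp_base * (\<Sum>c\<in>roots. lagrange_weight c * branch c ^ 0) - fps_const (1 / w) * exp_base * (\<Sum>c\<in>roots. lagrange_weight c * branch c ^ m)"
    unfolding sum_subtractf sum_distrib_left ..
  also have "(\<Sum>c\<in>roots. lagrange_weight c * branch c ^ 0) = 0"
    using lagrange_sum[OF finite_roots lagrange_weight, of 0] card_roots m by simp
  also have "(\<Sum>c\<in>roots. lagrange_weight c * branch c ^ m) = 1"
    using lagrange_sum[OF finite_roots lagrange_weight, of m] card_roots by simp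
  finally show ?thesis by (simp add: fps_eq_iff)
qed

text \<open>The lowest coefficient of a multiple of \<open>1 + u\<close> meets only the constant terms of the
weights, for which \<open>v\<close> is \<open>(1 + u) / u\<close> and \<open>x\<close> is \<open>1 + u\<close>.\<close>

lemma functional_nth_lowest:
  assumes g: "g = fps_const [:1, 1:] * h" and h: "agree n h 0"
  shows "functional g $ n = (\<Sum>c\<in>roots. lagrange_weight c $ 0 * (c / (1 + c)) * eval_u c (h $ n))"
  unfolding functional_def fps_sum_nth
proof (intro sum.cong refl)
  fix c assume c: "c \<in> roots"
  have "(f * at_u c g) $ n = f $ 0 * at_u c g $ n" for f
  proof -
    have "(f * at_u c g) $ n = (\<Sum>i=0..n. if i = 0 then f $ 0 * at_u c g $ n else 0)"
      unfolding fps_mult_nth using h by (intro sum.cong refl) (auto simp: agree_def g)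
    then show ?thesis by simp
  qed
  then show "(lagrange_weight c * branch_inv c * x_inv c * at_u c g) $ n = lagrange_weight c $ 0 * (c / (1 + c)) * eval_u c (h $ n)"
    using root_nonzero[OF c] by (simp add: branch_inv_def x_inv_def g)
qed

end

text \<open>Both sides are multiples of \<open>1 + u\<close>, and the functional takes the same value on them for every generic
\<open>w\<close>. The lowest coefficient of their difference would contradict \<open>kernel_sum_nonzero\<close>.\<close>

theorem rise_total_eq_closed_form:
  assumes m: "m \<ge> 1"
  shows "rise_total m = closed_form m"
proof -
  obtain h1 where h1: "rise_total m = fps_const [:1, 1:] * h1" using rise_total_factor by blast
  have h2: "closed_form m = fps_const [:1, 1:] * (exp_z [:of_nat m + 1, - (of_nat m - 1):] *
     (1 + divide_u (1 - exp_z [:0, of_nat m:])))" (is "_ = _ * ?h2")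
    by (simp only: closed_form_def mult.assoc)
  define h where "h = h1 - ?h2"
  have gh: "rise_total m - closed_form m = fps_const [:1, 1:] * h"
    unfolding h_def h1 h2 right_diff_distrib ..
  have "h = 0"
  proof (rule ccontr)
    assume "h \<noteq> 0"
    define n where "n = subdegree h"
    have hn: "h $ n \<noteq> 0" using \<open>h \<noteq> 0\<close> by (simp add: n_def)
    have hl: "agree n h 0" by (simp add: n_def agree_def nth_less_subdegree_zero)
    have "map_poly of_rat (h $ n) \<noteq> (0 :: complex poly)"
    proof
      assume "map_poly of_rat (h $ n) = (0 :: complex poly)"
      then have "coeff (map_poly of_rat (h $ n)) i = (0 :: complex)" for i by simp
      then have "h $ n = 0" by (intro poly_eqI) (simp add: coeff_map_poly)
      with hn show False ..
    qed
    from kernel_sum_nonzero[OF m this] obtain w where w: "generic m w" and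
      nz: "\<And>K. (\<forall>c\<in>kernel_roots m w. K c * (\<Prod>l\<in>kernel_roots m w - {c}. (1 + c) / c - (1 + l) / l) = 1)
        \<Longrightarrow> (\<Sum>c\<in>kernel_roots m w. K c * (c / (1 + c)) * eval_u c (h $ n)) \<noteq> 0"
      unfolding eval_u_def by blast
    have "functional m w (rise_total m - closed_form m) = 0"
      by (simp add: functional_diff[OF m w] functional_rise_total[OF m w] functional_closed_form[OF m w])
    with functional_nth_lowest[OF m w gh hl]
    have "(\<Sum>c\<in>kernel_roots m w. lagrange_weight m w c $ 0 * (c / (1 + c)) * eval_u c (h $ n)) = 0" by simp
    with nz[of "\<lambda>c. lagrange_weight m w c $ 0"] lagrange_weight_0[OF m w] show False by blast
  qed
  with gh show ?thesis by simp
qed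

section \<open>The substitution for t and x\<close>

lemma at_0_nth: "at_0 g $ n = [:poly (g $ n) 0:]"
  by (simp add: at_0_def poly_0_coeff_0)

lemma sum_pCons_0: "(\<Sum>i\<in>A. [:f i:]) = [:\<Sum>i\<in>A. f i :: 'a :: comm_monoid_add:]"
  by (induction A rule: infinite_finite_induct) simp_all

lemma at_0_simps [simp]:
  "at_0 1 = 1" "at_0 fps_X = fps_X" "at_0 (f + g) = at_0 f + at_0 g" "at_0 (f - g) = at_0 f - at_0 g"
  "at_0 (f * g) = at_0 f * at_0 g" "at_0 (fps_const p) = fps_const [:poly p 0:]"
  by (rule fps_ext; simp add: at_0_nth fps_mult_nth poly_sum sum_pCons_0 one_pCons fps_X_def mult.commute)+

lemma at_0_power [simp]: "at_0 (f ^ n) = at_0 f ^ n"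
  by (induction n) simp_all

lemma at_0_exp_z [simp]: "at_0 (exp_z p) = exp_z [:poly p 0:]"
  by (rule fps_ext) (simp add: at_0_nth exp_z_def poly_const_pow)

lemma exp_z_0 [simp]: "exp_z 0 = 1"
  by (rule fps_ext) (simp add: exp_z_def power_0_left)

lemma at_0_x_series [simp]: "at_0 (x_series m) = 1"
  by (simp add: x_series_def one_pCons flip: fps_const_1_eq_1)

lemma at_0_t_series [simp]: "at_0 (t_series m) = t_series m"
  by (simp add: t_series_def)

lemma eval_x_simps [simp]:
  "eval_x 0 X = 0" "eval_x 1 X = 1" "eval_x (p + q) X = eval_x p X + eval_x q X"
  "eval_x (p * q) X = eval_x p X * eval_x q X"
  "eval_x (pCons a p) X = fps_const [:a:] + X * eval_x p X"
proof -
  note hom = map_poly_hom_add[of "\<lambda>a. fps_const [:a:]"] map_poly_hom_mult[of "\<lambda>a. fps_const [:a:]"]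
  show "eval_x (p + q) X = eval_x p X + eval_x q X" "eval_x (p * q) X = eval_x p X * eval_x q X"
    unfolding eval_x_def by (simp_all add: hom flip: fps_const_add)
  show "eval_x 0 X = 0" "eval_x 1 X = 1" "eval_x (pCons a p) X = fps_const [:a:] + X * eval_x p X"
    unfolding eval_x_def by (simp_all add: map_poly_pCons map_poly_1')
qed

lemma eval_x_sum: "eval_x (\<Sum>i\<in>A. f i) X = (\<Sum>i\<in>A. eval_x (f i) X)"
  by (induction A rule: infinite_finite_induct) simp_all

definition substitute_term :: "nat \<Rightarrow> rat poly fps \<Rightarrow> nat \<Rightarrow> rat poly fps" where
  "substitute_term m f i = eval_x (f $ i) (x_series m) * t_series m ^ i"

text \<open>Since \<open>t\<close> is divisible by \<open>z\<close>, each coefficient in \<open>z\<close> is a finite sum.\<close>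

definition substitute :: "nat \<Rightarrow> rat poly fps \<Rightarrow> rat poly fps" where
  "substitute m f = Abs_fps (\<lambda>n. \<Sum>i\<le>n. substitute_term m f i $ n)"

lemma t_series_power_nth: "n < i \<Longrightarrow> (g * t_series m ^ i) $ n = 0"
  unfolding t_series_def power_mult_distrib
  by (subst mult.left_commute) (simp add: fps_X_power_mult_nth)

lemma substitute_term_nth: "n < i \<Longrightarrow> substitute_term m f i $ n = 0"
  unfolding substitute_term_def by (rule t_series_power_nth)

lemma substitute_nth:
  assumes "n \<le> N"
  shows "substitute m f $ n = (\<Sum>i\<le>N. substitute_term m f i) $ n"
proof -
  have "(\<Sum>i\<le>N. substitute_term m f i $ n) = (\<Sum>i\<le>n. substitute_term m f i $ n)"
    using assms by (intro sum.mono_neutral_right) (auto simp: substitute_term_nth)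
  then show ?thesis by (simp add: substitute_def fps_sum_nth)
qed

lemma substitute_sums: "(\<lambda>n. eval_x (f $ n) (x_series m) * t_series m ^ n) sums substitute m f"
  unfolding sums_def
proof (rule tendsto_fpsI)
  fix n
  show "\<forall>\<^sub>F N in sequentially.
    (\<Sum>i<N. eval_x (f $ i) (x_series m) * t_series m ^ i) $ n = substitute m f $ n"
    using eventually_ge_at_top[of "Suc n"]
  proof eventually_elim
    case (elim N)
    then obtain N' where "N = Suc N'" "n \<le> N'" by (cases N) auto
    then show ?case using substitute_nth[of n N' m f] by (simp add: substitute_term_def lessThan_Suc_atMost)
  qed
qed

lemma substitute_add: "substitute m (f + g) = substitute m f + substitute m g"
  by (rule fps_ext) (simp add: substitute_def substitute_term_def distrib_right sum.distrib)

lemma substitute_const: "substitute m (fps_const p) = eval_x p (x_series m)"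
proof (rule fps_ext)
  fix n
  have "substitute m (fps_const p) $ n = (\<Sum>i\<le>n. if i = 0 then eval_x p (x_series m) $ n else 0)"
    unfolding substitute_def fps_nth_Abs_fps by (intro sum.cong refl) (simp add: substitute_term_def)
  then show "substitute m (fps_const p) $ n = eval_x p (x_series m) $ n" by simp
qed

lemma substitute_X: "substitute m fps_X = t_series m"
proof (rule fps_ext)
  fix n
  have "substitute m fps_X $ n = (\<Sum>i\<le>Suc n. substitute_term m fps_X i) $ n" by (rule substitute_nth) simp
  also have "(\<Sum>i\<le>Suc n. substitute_term m fps_X i) = (\<Sum>i\<le>Suc n. if i = 1 then t_series m else 0)"
    by (intro sum.cong refl) (simp add: substitute_term_def fps_X_def)
  finally show "substitute m fps_X $ n = t_series m $ n" by simp
qed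

lemma substitute_mult: "substitute m (f * g) = substitute m f * substitute m g"
proof (rule fps_ext)
  fix n
  let ?t = "\<lambda>i j. eval_x (f $ i) (x_series m) * eval_x (g $ j) (x_series m) * t_series m ^ (i + j)"
  have "(substitute m f * substitute m g) $ n = ((\<Sum>i\<le>n. substitute_term m f i) * (\<Sum>j\<le>n. substitute_term m g j)) $ n"
    unfolding fps_mult_nth by (intro sum.cong refl) (simp add: substitute_nth)
  also have "\<dots> = (\<Sum>i\<le>n. \<Sum>j\<le>n. ?t i j $ n)"
    by (simp add: sum_product fps_sum_nth substitute_term_def power_add mult_ac)
  also have "\<dots> = (\<Sum>(i, j)\<in>{..n} \<times> {..n}. ?t i j $ n)"
    by (simp add: sum.cartesian_product)
  also have "\<dots> = (\<Sum>(i, j)\<in>{(i, j). i + j \<le> n}. ?t i j $ n)"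
  proof (rule sum.mono_neutral_right)
    show "\<forall>p\<in>{..n} \<times> {..n} - {(i, j). i + j \<le> n}. (case p of (i, j) \<Rightarrow> ?t i j $ n) = 0"
      by (auto intro!: t_series_power_nth)
  qed auto
  also have "\<dots> = (\<Sum>k\<le>n. \<Sum>i\<le>k. ?t i (k - i) $ n)"
    by (rule sum.triangle_reindex_eq)
  also have "\<dots> = (\<Sum>k\<le>n. substitute_term m (f * g) k $ n)"
    by (intro sum.cong refl)
      (simp add: substitute_term_def fps_mult_nth eval_x_sum sum_distrib_right fps_sum_nth atLeast0AtMost)
  finally show "substitute m (f * g) $ n = (substitute m f * substitute m g) $ n"
    by (simp add: substitute_def)
qed

text \<open>The remainder of \<open>f\<close> at \<open>x = 1\<close> is free of \<open>x\<close>, so its substitution is free of \<open>u\<close>; and \<open>x - 1\<close> vanishes at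
\<open>u = 0\<close>.\<close>

lemma substitute_divided_difference:
  "(x_series m - 1) * substitute m (divided_difference f) = substitute m f - at_0 (substitute m f)"
proof -
  define f1 where "f1 = Abs_fps (\<lambda>n. [:poly (f $ n) 1:])"
  have "f = fps_const [:- 1, 1:] * divided_difference f + f1"
    by (rule fps_ext) (simp only: fps_add_nth fps_mult_left_const_nth divided_difference_def f1_def
        fps_nth_Abs_fps synthetic_div_correct')
  then have "substitute m f = eval_x [:- 1, 1:] (x_series m) * substitute m (divided_difference f) + substitute m f1"
    by (metis substitute_add substitute_mult substitute_const)
  also have "eval_x [:- 1, 1:] (x_series m) = x_series m - 1"
    by (simp add: one_pCons fps_eq_iff)
  finally have f: "substitute m f = (x_series m - 1) * substitute m (divided_difference f) + substitute m f1" .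
  have "at_0 (substitute_term m f1 i) = substitute_term m f1 i" for i
    by (simp add: substitute_term_def f1_def)
  then have "at_0 (substitute m f1) = substitute m f1"
    by (simp add: fps_eq_iff at_0_nth substitute_def poly_sum sum_pCons_0[symmetric])
  with f have "at_0 (substitute m f) = substitute m f1" by simp
  with f show ?thesis by simp
qed

section \<open>The generating function is the closed form\<close>

lemma x_series_0: "(x_series m - 1) $ 0 = [:0, 1:]"
  by (simp add: x_series_def exp_z_def one_pCons)

text \<open>Both sides become explicit when multiplied by \<open>u (x - 1)\<close>, whose lowest coefficient is \<open>u\<^sup>2 \<noteq> 0\<close>.\<close>

lemma interval_gf_agree_step:
  assumes F: "agree n (substitute m (tamari_gf_y1 m)) (closed_form m)"
    and g: "agree n (substitute m g) h"
  shows "agree n (substitute m (tamari_gf_y1 m * divided_difference g)) (kernel_op m h)"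
proof (rule agree_cancel)
  let ?u = "fps_const [:0, 1:] :: rat poly fps"
  have "?u * (x_series m - 1) * substitute m (tamari_gf_y1 m * divided_difference g) =
      ?u * substitute m (tamari_gf_y1 m) * ((x_series m - 1) * substitute m (divided_difference g))"
    unfolding substitute_mult by (simp only: ac_simps)
  also have "\<dots> = ?u * substitute m (tamari_gf_y1 m) * (substitute m g - at_0 (substitute m g))"
    unfolding substitute_divided_difference ..
  finally have 1: "?u * (x_series m - 1) * substitute m (tamari_gf_y1 m * divided_difference g) =
    ?u * substitute m (tamari_gf_y1 m) * (substitute m g - at_0 (substitute m g))" .
  have "?u * (x_series m - 1) * kernel_op m h =
      ((x_series m - 1) * closed_form_quotient m) * (?u * divide_u (h - at_0 h))"
    unfolding kernel_op_def by (simp only: ac_simps)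
  also have "\<dots> = ?u * closed_form m * (h - at_0 h)"
    unfolding closed_form_quotient[symmetric] divide_u_at_0 ..
  finally have 2: "?u * (x_series m - 1) * kernel_op m h = ?u * closed_form m * (h - at_0 h)" .
  show "agree n (?u * (x_series m - 1) * substitute m (tamari_gf_y1 m * divided_difference g))
      (?u * (x_series m - 1) * kernel_op m h)"
    unfolding 1 2 using g
    by (intro agree_mult agree_refl F) (simp add: agree_def at_0_def)
  show "(?u * (x_series m - 1)) $ 0 \<noteq> 0"
    unfolding fps_mult_left_const_nth x_series_0 by simp
qed

lemma interval_gf_agree:
  assumes F: "agree n (substitute m (tamari_gf_y1 m)) (closed_form m)"
    and g: "agree n (substitute m (interval_gf m 0 r)) h"
  shows "agree n (substitute m (interval_gf m k r)) ((kernel_op m ^^ k) h)"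
proof (induction k)
  case (Suc k)
  then show ?case using interval_gf_agree_step[OF F Suc] by (simp add: interval_gf_east)
qed (simp add: g)

text \<open>The factor \<open>t\<close> in the recursion gains one order.\<close>

lemma rise_agree:
  assumes F: "agree n (substitute m (tamari_gf_y1 m)) (closed_form m)"
  shows "agree (Suc n) (substitute m (interval_gf m 0 r)) (rise_series m r)"
proof (induction r)
  case 0
  have "substitute m (interval_gf m 0 0) = x_series m"
    unfolding interval_gf_0 substitute_const by (simp add: monom_Suc monom_0)
  then show ?case by (simp add: agree_refl)
next
  case (Suc r)
  have "eval_x (monom a 1) (x_series m) = x_series m * fps_const [:a:]" for a
    by (simp add: monom_Suc monom_0)
  then have "substitute m (interval_gf m 0 (Suc r)) =
      fps_const [:1 / of_nat (Suc r):] * t_series m * x_series m * substitute m (interval_gf m m r)"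
    unfolding interval_gf_north substitute_mult substitute_X substitute_const by (simp only: ac_simps)
  moreover have "agree n (substitute m (interval_gf m m r)) ((kernel_op m ^^ m) (rise_series m r))"
    using agree_less[OF Suc] by (intro interval_gf_agree F) simp
  ultimately show ?case using agree_t_series by simp
qed

lemma substitute_tamari_gf_nth:
  "substitute m (tamari_gf_y1 m) $ n = (\<Sum>r\<le>n. substitute m (interval_gf m 0 r) $ n)"
proof -
  have "substitute m (tamari_gf_y1 m) $ n =
      (\<Sum>i\<le>n. \<Sum>r\<le>n. substitute_term m (interval_gf m 0 r) i $ n)"
    unfolding substitute_def fps_nth_Abs_fps
  proof (intro sum.cong refl)
    fix i assume i: "i \<in> {..n}"
    have "tamari_gf_y1 m $ i = (\<Sum>r\<le>n. interval_gf m 0 r $ i)"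
      unfolding tamari_gf_y1_by_rise using i
      by (intro sum.mono_neutral_left) (auto simp: interval_gf_order)
    then show "substitute_term m (tamari_gf_y1 m) i $ n = (\<Sum>r\<le>n. substitute_term m (interval_gf m 0 r) i $ n)"
      by (simp add: substitute_term_def eval_x_sum sum_distrib_right fps_sum_nth)
  qed
  also have "\<dots> = (\<Sum>r\<le>n. substitute m (interval_gf m 0 r) $ n)"
    unfolding substitute_def fps_nth_Abs_fps by (rule sum.swap)
  finally show ?thesis .
qed

theorem substitute_tamari_gf:
  assumes m: "m \<ge> 1"
  shows "substitute m (tamari_gf_y1 m) = closed_form m"
proof -
  have "agree n (substitute m (tamari_gf_y1 m)) (closed_form m)" for n
  proof (induction n)
    case (Suc n)
    have "substitute m (tamari_gf_y1 m) $ i = closed_form m $ i" if "i < Suc n" for i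
    proof -
      have "substitute m (interval_gf m 0 r) $ i = rise_series m r $ i" for r
        using rise_agree[OF Suc, of r] that by (simp add: agree_def)
      then show ?thesis
        unfolding rise_total_eq_closed_form[OF m, symmetric] substitute_tamari_gf_nth rise_total_def by simp
    qed
    then show ?case by (simp add: agree_def)
  qed (simp add: agree_def)
  then show ?thesis by (auto simp: agree_def fps_eq_iff)
qed

section \<open>The specialisation x = 1\<close>

definition const_u :: "rat poly fps \<Rightarrow> rat fps" where
  "const_u g = Abs_fps (\<lambda>n. poly (g $ n) 0)"

lemma const_u_nth [simp]: "const_u g $ n = poly (g $ n) 0"
  by (simp add: const_u_def)

lemma const_u_simps [simp]:
  "const_u 0 = 0" "const_u 1 = 1" "const_u fps_X = fps_X" "const_u (f + g) = const_u f + const_u g"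
  "const_u (f * g) = const_u f * const_u g" "const_u (fps_const p) = fps_const (poly p 0)"
  by (rule fps_ext; simp add: fps_mult_nth poly_sum fps_X_def fps_const_def)+

lemma const_u_power [simp]: "const_u (f ^ n) = const_u f ^ n"
  by (induction n) simp_all

lemma const_u_exp_z [simp]: "const_u (exp_z p) = fps_exp (poly p 0)"
  by (rule fps_ext) (simp add: exp_z_def poly_power)

lemma const_u_eval_x: "const_u (eval_x p (x_series m)) = fps_const (poly p 1)"
proof (induction p)
  case (pCons a p)
  then show ?case by (simp add: x_series_def)
qed simp

text \<open>The limit of \<open>(1 - e\<^sup>m\<^sup>z\<^sup>u) / u\<close> at \<open>u = 0\<close> is \<open>- m z\<close>.\<close>

lemma const_u_closed_form: "const_u (closed_form m) = (1 - fps_const (of_nat m) * fps_X) * fps_exp (of_nat m + 1)"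
proof -
  have "const_u (divide_u (1 - exp_z [:0, of_nat m:])) = - (fps_const (of_nat m) * fps_X)"
  proof (rule fps_ext)
    fix k
    let ?d = "divide_u (1 - exp_z [:0, rat_of_nat m:])"
    have "(fps_const [:0, 1:] * ?d) $ k = (1 - exp_z [:0, rat_of_nat m:]) $ k"
      by (simp only: divide_u_exact)
    then have "pCons 0 (?d $ k) = (1 - exp_z [:0, rat_of_nat m:]) $ k" by simp
    then have "coeff (?d $ k) 0 = coeff ((1 - exp_z [:0, rat_of_nat m:]) $ k) 1"
      by (metis One_nat_def coeff_pCons_Suc)
    also have "\<dots> = (if k = 1 then - of_nat m else 0)"
    proof -
      have mon: "[:0, rat_of_nat m:] = monom (of_nat m) 1" by (simp add: monom_Suc monom_0)
      show ?thesis unfolding mon by (auto simp: exp_z_def monom_power)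
    qed
    finally show "const_u ?d $ k = (- (fps_const (of_nat m) * fps_X)) $ k"
      by (simp add: poly_0_coeff_0 fps_X_def)
  qed
  then show ?thesis by (simp add: closed_form_def mult.commute)
qed

lemma const_u_substitute:
  "const_u (substitute m f) = Abs_fps (\<lambda>n. poly (f $ n) 1) oo (fps_X * fps_exp (- of_nat (m * (m + 1))))"
proof (rule fps_ext)
  fix n
  have "const_u (substitute m f) $ n = (\<Sum>i\<le>n. const_u (substitute_term m f i) $ n)"
    by (simp add: substitute_def poly_sum)
  also have "\<dots> = (\<Sum>i\<le>n. poly (f $ i) 1 * (fps_X * fps_exp (- of_nat (m * (m + 1)))) ^ i $ n)"
    by (intro sum.cong refl) (simp add: substitute_term_def const_u_eval_x t_series_def del: const_u_nth of_nat_mult)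
  finally show "const_u (substitute m f) $ n =
      (Abs_fps (\<lambda>n. poly (f $ n) 1) oo (fps_X * fps_exp (- of_nat (m * (m + 1))))) $ n"
    by (simp add: fps_compose_nth atLeast0AtMost)
qed

section \<open>Lagrange inversion\<close>

text \<open>With \<open>t = z e\<^sup>-\<^sup>c\<^sup>z\<close>, this extracts the residue of \<open>t\<^sup>-\<^sup>n d(t\<^sup>k)\<close>: for \<open>k \<noteq> n\<close> it is that of an exact differential,
for \<open>k = n\<close> that of \<open>n dt / t\<close>.\<close>

lemma fps_nth_deriv_power_tree:
  fixes c :: "'a :: field_char_0"
  assumes "k \<le> n" "n \<ge> 1"
  shows "(fps_deriv ((fps_X * fps_exp (- c)) ^ k) * fps_exp (of_nat n * c)) $ (n - 1) =
    (if k = n then of_nat n else 0)"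
proof (cases k)
  case (Suc k')
  have "(fps_X * fps_exp (- c)) ^ k = fps_X ^ k * fps_exp (- (of_nat k * c))"
    by (simp add: power_mult_distrib fps_exp_power_mult)
  moreover have "fps_deriv (fps_X ^ k) = fps_const (of_nat k :: 'a) * fps_X ^ k'"
    by (simp only: Suc fps_deriv_power' fps_deriv_fps_X fps_of_nat diff_Suc_1 mult_1_right)
  moreover have "fps_deriv (fps_exp (- (of_nat k * c))) = - fps_const (of_nat k * c) * fps_exp (- (of_nat k * c))"
    by simp
  ultimately have "fps_deriv ((fps_X * fps_exp (- c)) ^ k) = fps_X ^ k' * fps_X *
      (- fps_const (of_nat k * c) * fps_exp (- (of_nat k * c))) +
      fps_const (of_nat k) * fps_X ^ k' * fps_exp (- (of_nat k * c))"
    by (simp only: fps_deriv_mult Suc power_Suc2)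
  also have "\<dots> = fps_X ^ k' *
      (fps_const (of_nat k) - fps_const (of_nat k * c) * fps_X) * fps_exp (- (of_nat k * c))"
    by (simp add: algebra_simps del: fps_const_neg fps_const_mult)
  finally have "fps_deriv ((fps_X * fps_exp (- c)) ^ k) = fps_X ^ k' *
      (fps_const (of_nat k) - fps_const (of_nat k * c) * fps_X) * fps_exp (- (of_nat k * c))" .
  then have "fps_deriv ((fps_X * fps_exp (- c)) ^ k) * fps_exp (of_nat n * c) = fps_X ^ k' *
      ((fps_const (of_nat k) - fps_const (of_nat k * c) * fps_X) *
        (fps_exp (- (of_nat k * c)) * fps_exp (of_nat n * c)))"
    by (simp only: ac_simps)
  also have "fps_exp (- (of_nat k * c)) * fps_exp (of_nat n * c) = fps_exp (of_nat (n - k) * c)"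
    unfolding fps_exp_add_mult[symmetric] using assms by (simp add: of_nat_diff algebra_simps)
  finally have e: "(fps_deriv ((fps_X * fps_exp (- c)) ^ k) * fps_exp (of_nat n * c)) $ (n - 1) =
     ((fps_const (of_nat k) - fps_const (of_nat k * c) * fps_X) * fps_exp (of_nat (n - k) * c)) $ (n - k)"
    using assms Suc by (simp add: fps_X_power_mult_nth)
  show ?thesis
  proof (cases "n - k")
    case 0
    with assms show ?thesis unfolding e by simp
  next
    case (Suc d)
    have "((fps_const (of_nat k) - fps_const (of_nat k * c) * fps_X) * fps_exp (of_nat (Suc d) * c)) $ Suc d
      = of_nat k * ((of_nat (Suc d) * c) ^ Suc d / fact (Suc d)) - of_nat k * c * ((of_nat (Suc d) * c) ^ d / fact d)"
      by (simp add: left_diff_distrib mult.assoc del: of_nat_Suc fact_Suc power_Suc)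
    also have "\<dots> = 0"
      by (simp add: field_simps del: of_nat_Suc)
    finally show ?thesis unfolding e using Suc assms by simp
  qed
qed (use assms in simp)

lemma fps_lagrange_exp:
  fixes H :: "'a :: field_char_0 fps"
  assumes "n \<ge> 1"
  shows "of_nat n * H $ n =
    (fps_deriv (H oo (fps_X * fps_exp (- c))) * fps_exp (of_nat n * c)) $ (n - 1)"
proof -
  let ?t = "fps_X * fps_exp (- c)"
  have t0: "(?t ^ k) $ i = 0" if "i < k" for i k
    using that by (simp add: power_mult_distrib fps_X_power_mult_nth)
  have "(H oo ?t) $ i = (\<Sum>k\<le>n. H $ k * (?t ^ k) $ i)" if "i \<le> n" for i
    unfolding fps_compose_nth atLeast0AtMost using that t0
    by (intro sum.mono_neutral_left) auto
  then have "(fps_deriv (H oo ?t) * fps_exp (of_nat n * c)) $ (n - 1) =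
     (fps_deriv (\<Sum>k\<le>n. fps_const (H $ k) * ?t ^ k) * fps_exp (of_nat n * c)) $ (n - 1)"
    using assms unfolding fps_mult_nth by (intro sum.cong refl) (simp add: fps_sum_nth)
  also have "\<dots> = (\<Sum>k\<le>n. H $ k * (fps_deriv (?t ^ k) * fps_exp (of_nat n * c)) $ (n - 1))"
    by (simp add: fps_deriv_sum sum_distrib_right fps_sum_nth mult.assoc)
  also have "\<dots> = (\<Sum>k\<le>n. if k = n then of_nat n * H $ n else 0)"
    using fps_nth_deriv_power_tree[of _ n c] assms by (intro sum.cong refl) auto
  finally show ?thesis by simp
qed

text \<open>Put \<open>a = m + 1\<close>, \<open>c = m a\<close> and \<open>N = m n + 1\<close>. The right-hand side has the derivative \<open>(1 - c z) e\<^sup>a\<^sup>z\<close>, and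
\<open>a + c n = a N\<close>. So \<open>n [t\<^sup>n]\<close> is the coefficient of \<open>z\<^sup>n\<^sup>-\<^sup>1\<close> in \<open>(1 - c z) e\<^sup>a\<^sup>N\<^sup>z\<close>, where
\<open>a N - c (n - 1) = a\<^sup>2\<close>.\<close>

lemma tamari_coefficient:
  assumes "H oo (fps_X * fps_exp (- of_nat (m * (m + 1)))) =
    (1 - fps_const (of_nat m) * fps_X) * fps_exp (rat_of_nat m + 1)"
  shows "fact n * H $ n = of_nat (m + 1) ^ n * of_nat (m * n + 1) powi (int n - 2)"
proof (cases n)
  case 0
  have "(H oo (fps_X * fps_exp (- of_nat (m * (m + 1))))) $ 0 = H $ 0" by simp
  then have "H $ 0 = 1" unfolding assms by simp
  then show ?thesis by (simp add: 0)
next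
  case (Suc n')
  define a where "a = rat_of_nat m + 1"
  define N where "N = rat_of_nat (m * n + 1)"
  let ?c = "rat_of_nat (m * (m + 1))"
  have c: "?c = of_nat m * a" by (simp add: a_def algebra_simps)
  have aN: "a + of_nat n * ?c = a * N" by (simp add: a_def N_def algebra_simps)
  have N0: "N \<noteq> 0" unfolding N_def of_nat_eq_0_iff by simp
  have "fps_deriv ((1 - fps_const (of_nat m) * fps_X) * fps_exp a) =
      (1 - fps_const ?c * fps_X) * fps_exp a"
    unfolding c by (simp add: a_def algebra_simps flip: fps_const_mult fps_const_add)
  then have "of_nat n * H $ n = ((1 - fps_const ?c * fps_X) * fps_exp a * fps_exp (of_nat n * ?c)) $ n'"
    using fps_lagrange_exp[of n H ?c] assms Suc by (simp add: a_def)
  also have "(1 - fps_const ?c * fps_X) * fps_exp a * fps_exp (of_nat n * ?c) =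
      (1 - fps_const ?c * fps_X) * fps_exp (a * N)"
    unfolding aN[symmetric] fps_exp_add_mult by (simp only: mult.assoc)
  finally have nH: "of_nat n * H $ n = ((1 - fps_const ?c * fps_X) * fps_exp (a * N)) $ n'" .
  have "fact n * H $ n = fact n' * (of_nat n * H $ n)" by (simp add: Suc)
  also have "\<dots> = a ^ n * N powi (int n - 2)"
  proof (cases n')
    case 0
    then have "N = a" using Suc by (simp add: N_def a_def)
    then show ?thesis unfolding nH using 0 Suc N0 by (simp add: power_int_minus)
  next
    case (Suc n'')
    have n: "n = Suc (Suc n'')" using \<open>n = Suc n'\<close> Suc by simp
    have "fact n' * (of_nat n * H $ n) = fact (Suc n'') *
       ((a * N) ^ Suc n'' / fact (Suc n'') - ?c * ((a * N) ^ n'' / fact n''))"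
      unfolding nH Suc by (simp add: left_diff_distrib mult.assoc del: fact_Suc power_Suc of_nat_mult)
    also have "\<dots> = (a * N) ^ n'' * (a * N - ?c * of_nat (Suc n''))"
      by (simp add: field_simps del: of_nat_mult of_nat_Suc) 
    also have "a * N - ?c * of_nat (Suc n'') = a ^ 2"
      unfolding aN[symmetric] c n by (simp add: a_def power2_eq_square algebra_simps)
    also have "(a * N) ^ n'' * a\<^sup>2 = a ^ n * N powi (int n - 2)"
      by (simp add: n power_mult_distrib power2_eq_square)
    finally show ?thesis .
  qed
  finally show ?thesis by (simp add: a_def N_def add.commute)
qed

lemma card_labelled_intervals:
  "of_nat (card (labelled_intervals m n)) = fact n * (tamari_gf_x1_y1 m $ n)"
  by (simp add: tamari_gf_x1_y1_def tamari_gf_y1_def tamari_gf_def poly_sum poly_monom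
      case_prod_unfold)

theorem theorem2:
  fixes m :: nat
  assumes "m \<ge> 1"
  shows
    "((\<lambda>n. eval_x (tamari_gf_y1 m $ n) (x_series m) * t_series m ^ n) sums
       (fps_const [:1, 1:] * exp_z [:of_nat m + 1, - (of_nat m - 1):] *
         (1 + divide_u (1 - exp_z [:0, of_nat m:])))) \<and>
     tamari_gf_x1_y1 m oo (fps_X * fps_exp (- of_nat (m * (m + 1)))) =
       (1 - fps_const (of_nat m) * fps_X) * fps_exp (of_nat m + 1) \<and>
     (\<forall>n. of_nat (card (labelled_intervals m n)) = fact n * (tamari_gf_x1_y1 m $ n) \<and>
          fact n * (tamari_gf_x1_y1 m $ n) =
            of_nat (m + 1) ^ n * of_nat (m * n + 1) powi (int n - 2))"
proof (intro conjI allI)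
  have sub: "substitute m (tamari_gf_y1 m) = closed_form m" using assms by (rule substitute_tamari_gf)
  show "(\<lambda>n. eval_x (tamari_gf_y1 m $ n) (x_series m) * t_series m ^ n) sums
       (fps_const [:1, 1:] * exp_z [:of_nat m + 1, - (of_nat m - 1):] *
         (1 + divide_u (1 - exp_z [:0, of_nat m:])))"
    using substitute_sums[of "tamari_gf_y1 m" m] unfolding sub closed_form_def .
  show x1: "tamari_gf_x1_y1 m oo (fps_X * fps_exp (- of_nat (m * (m + 1)))) =
       (1 - fps_const (of_nat m) * fps_X) * fps_exp (of_nat m + 1)"
    using const_u_substitute[of m "tamari_gf_y1 m"] unfolding sub const_u_closed_form tamari_gf_x1_y1_def by simp
  fix n
  show "of_nat (card (labelled_intervals m n)) = fact n * (tamari_gf_x1_y1 m $ n)"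
    by (rule card_labelled_intervals)
  show "fact n * (tamari_gf_x1_y1 m $ n) =
            of_nat (m + 1) ^ n * of_nat (m * n + 1) powi (int n - 2)"
    using x1 by (rule tamari_coefficient)
qed

end
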